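(* (i) A Hamel spray $\bar{\mathbf{G}}$ is of scalar curvature if and only if its Riemann curvature has the form $$\bar R^i_{\ k}=\lambda\,(Q^2\delta^i_k-QQ_{.k}y^i),\qquad ( * )$$ where $\lambda=\lambda(x,y)$ is a scalar function and $Q$ is the adjoint Hamel function of $\bar{\mathbf{G}}$. (ii) A Funk spray $\bar{\mathbf{G}}$ is of isotropic curvature if and only if its Riemann curvature has the form $( * )$, where $\lambda=\lambda(x)$ is a scalar function (depending on $x$ only) and $Q$ is the adjoint Funk function of $\bar{\mathbf{G}}$.
   Context: A conical region $\mathcal{C}$ of $TM\setminus\{0\}$ is an open set such that each $\mathcal{C}_x=\mathcal{C}\cap (T_xM\setminus\{0\})$ is closed under $y\mapsto\lambda y$, $\lambda>0$. A spray on an $n$-dimensional manifold $M$ is a smooth vector field on a conical region, locally $\mathbf{G}=y^i\frac{\partial}{\partial x^i}-2G^i\frac{\partial}{\partial y^i}$ with $G^i$ positively homogeneous of degree two in $y$. Put $\partial_k=\partial/\partial x^k$, $\dot\partial_k=\partial/\partial y^k$, $G^r_i=\dot\partial_iG^r$, $G^r_{ij}=\dot\partial_j\dot\partial_iG^r$, $\delta_i=\partial_i-G^r_i\dot\partial_r$. For a function $f$: $f_{.i}=\dot\partial_if$, $f_{;i}=\delta_if$, $f_{;0}=f_{;i}y^i$, $f_{.i;j}=\delta_jf_{.i}-f_{.r}G^r_{ij}$, $f_{.i;0}=f_{.i;j}y^j$. Riemann curvature of a spray: $R^i_{\ k}=2\partial_kG^i-y^j\partial_j\dot\partial_kG^i+2G^j\dot\partial_j\dot\partial_kG^i-(\dot\partial_jG^i)(\dot\partial_kG^j)$.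 The spray is of scalar curvature if $R^i_{\ k}=R\delta^i_k-\tau_ky^i$ for some homogeneous functions $R(x,y),\tau_k(x,y)$; of isotropic curvature if moreover $R_{.i}=2\tau_i$. A Hamel function (resp. Funk function) of a spray $\mathbf{G}$ is a function $Q$, positively homogeneous of degree one in $y$, with $Q_{;k}=Q_{.k;0}$ (resp. $Q_{;k}=QQ_{.k}$). Every Funk function is a Hamel function. For a spray $\mathbf{G}$ and a nonzero Hamel function $Q$ of $\mathbf{G}$, the spray $\bar G^i:=G^i+\frac{Q_{;0}}{2Q}y^i$ is called the Hamel spray associated to $(\mathbf{G},Q)$, and $\mathbf{G}$, $Q$ are its adjoint spray and adjoint Hamel function. If $Q$ is a Funk function of $\mathbf{G}$, $\bar{\mathbf{G}}$ is called the Funk spray associated to $(\mathbf{G},Q)$ and $Q$ its adjoint Funk function.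
   Formalization: In (ii), "isotropic implies λ=λ(x)" is false if some fibre C_x is disconnected; it is proved for connected fibres, and for every conical region with λ depending only on x along each connected component of C_x. *)

theory Defs
  imports "HOL-Analysis.Analysis"
begin

section \<open>Smooth functions and smooth manifolds\<close>

primrec Ck_on :: "nat \<Rightarrow> 'a set \<Rightarrow> ('a::real_normed_vector \<Rightarrow> 'b::real_normed_vector) \<Rightarrow> bool" where
  "Ck_on 0 S f \<longleftrightarrow> continuous_on S f"
| "Ck_on (Suc k) S f \<longleftrightarrow> (\<forall>z\<in>S. f differentiable (at z)) \<and>
     (\<forall>v. Ck_on k S (\<lambda>z. frechet_derivative f (at z) v))"

text \<open>Only used for open \<open>S\<close> in a finite-dimensional space, where it is the usual notion.\<close>
definition smooth_on :: "'a set \<Rightarrow> ('a::real_normed_vector \<Rightarrow> 'b::real_normed_vector) \<Rightarrow> bool" where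
  "smooth_on S f \<longleftrightarrow> (\<forall>k. Ck_on k S f)"

text \<open>A chart is a domain together with a coordinate map; the values of the coordinate map off the
  domain are irrelevant.\<close>
type_synonym ('m, 'n) chart = "'m set \<times> ('m \<Rightarrow> real ^ 'n)"

definition chart_image :: "('m, 'n::finite) chart \<Rightarrow> (real ^ 'n) set" where
  "chart_image c = snd c ` fst c"

definition chart_inv :: "('m, 'n::finite) chart \<Rightarrow> real ^ 'n \<Rightarrow> 'm" where
  "chart_inv c = inv_into (fst c) (snd c)"

definition transition :: "('m, 'n::finite) chart \<Rightarrow> ('m, 'n) chart \<Rightarrow> real ^ 'n \<Rightarrow> real ^ 'n" where
  "transition c c' = snd c' \<circ> chart_inv c"

definition is_chart :: "'m topology \<Rightarrow> ('m, 'n::finite) chart \<Rightarrow> bool" where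
  "is_chart X c \<longleftrightarrow> openin X (fst c) \<and> open (chart_image c) \<and>
     homeomorphic_map (subtopology X (fst c)) (top_of_set (chart_image c)) (snd c)"

text \<open>The atlas need not be maximal. The dimension is \<open>CARD('n)\<close>.\<close>
definition smooth_manifold :: "'m topology \<Rightarrow> ('m, 'n::finite) chart set \<Rightarrow> bool" where
  "smooth_manifold X A \<longleftrightarrow> Hausdorff_space X \<and> second_countable X \<and>
     (\<forall>c\<in>A. is_chart X c) \<and> (\<Union>c\<in>A. fst c) = topspace X \<and>
     (\<forall>c\<in>A. \<forall>c'\<in>A. smooth_on (snd c ` (fst c \<inter> fst c')) (transition c c'))"

section \<open>The tangent bundle\<close>

text \<open>A tangent vector at \<open>p\<close> is the family of its component columns with respect to all charts
  around \<open>p\<close>, related by the Jacobians of the transition maps (and set to 0 at all other indices,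
  to make the representation unique).\<close>
type_synonym ('m, 'n) tangent = "'m \<times> (('m, 'n) chart \<Rightarrow> real ^ 'n)"

definition tangent_bundle :: "('m, 'n::finite) chart set \<Rightarrow> ('m, 'n) tangent set" where
  "tangent_bundle A = {(p, v). p \<in> (\<Union>c\<in>A. fst c) \<and>
     (\<forall>c. c \<notin> A \<or> p \<notin> fst c \<longrightarrow> v c = 0) \<and>
     (\<forall>c\<in>A. \<forall>c'\<in>A. p \<in> fst c \<and> p \<in> fst c' \<longrightarrow>
        v c' = frechet_derivative (transition c c') (at (snd c p)) (v c))}"

definition zero_section :: "('m, 'n::finite) tangent set" where
  "zero_section = {(p, v). v = (\<lambda>_. 0)}"

definition tscale :: "real \<Rightarrow> ('m, 'n::finite) tangent \<Rightarrow> ('m, 'n) tangent" where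
  "tscale r \<xi> = (fst \<xi>, \<lambda>c. r *\<^sub>R snd \<xi> c)"

text \<open>The tangent vector with induced coordinates \<open>(x, y)\<close> in the chart \<open>c\<close>.\<close>
definition tvec :: "('m, 'n::finite) chart set \<Rightarrow> ('m, 'n) chart \<Rightarrow>
    (real ^ 'n) \<times> (real ^ 'n) \<Rightarrow> ('m, 'n) tangent" where
  "tvec A c z = (chart_inv c (fst z), \<lambda>c'. if c' \<in> A \<and> chart_inv c (fst z) \<in> fst c'
      then frechet_derivative (transition c c') (at (fst z)) (snd z) else 0)"

text \<open>The coordinate image of the part of \<open>C\<close> lying over the domain of \<open>c\<close>.\<close>
definition coord_dom :: "('m, 'n::finite) chart set \<Rightarrow> ('m, 'n) tangent set \<Rightarrow> ('m, 'n) chart \<Rightarrow>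
    ((real ^ 'n) \<times> (real ^ 'n)) set" where
  "coord_dom A C c = {z. fst z \<in> chart_image c \<and> tvec A c z \<in> C}"

definition conical_region :: "('m, 'n::finite) chart set \<Rightarrow> ('m, 'n) tangent set \<Rightarrow> bool" where
  "conical_region A C \<longleftrightarrow> C \<subseteq> tangent_bundle A - zero_section \<and>
     (\<forall>c\<in>A. open (coord_dom A C c)) \<and> (\<forall>\<xi>\<in>C. \<forall>r>0. tscale r \<xi> \<in> C)"

text \<open>The fibre of \<open>C\<close> over the point with coordinates \<open>x\<close>, read in the chart \<open>c\<close>.\<close>
definition coord_fibre :: "('m, 'n::finite) chart set \<Rightarrow> ('m, 'n) tangent set \<Rightarrow> ('m, 'n) chart \<Rightarrow>
    real ^ 'n \<Rightarrow> (real ^ 'n) set" where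
  "coord_fibre A C c x = {y. (x, y) \<in> coord_dom A C c}"

definition connected_fibres :: "('m, 'n::finite) chart set \<Rightarrow> ('m, 'n) tangent set \<Rightarrow> bool" where
  "connected_fibres A C \<longleftrightarrow> (\<forall>c\<in>A. \<forall>x\<in>chart_image c. connected (coord_fibre A C c x))"

text \<open>The coordinate expression \<open>f(x, y)\<close> in the chart \<open>c\<close> of a function on (a subset of) the
  tangent bundle.\<close>
definition coord_expr :: "('m, 'n::finite) chart set \<Rightarrow> ('m, 'n) chart \<Rightarrow>
    (('m, 'n) tangent \<Rightarrow> real) \<Rightarrow> (real ^ 'n) \<times> (real ^ 'n) \<Rightarrow> real" where
  "coord_expr A c f z = f (tvec A c z)"

definition smooth_fun :: "('m, 'n::finite) chart set \<Rightarrow> ('m, 'n) tangent set \<Rightarrow>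
    (('m, 'n) tangent \<Rightarrow> real) \<Rightarrow> bool" where
  "smooth_fun A C f \<longleftrightarrow> (\<forall>c\<in>A. smooth_on (coord_dom A C c) (coord_expr A c f))"

definition pos_homogeneous :: "('m, 'n::finite) tangent set \<Rightarrow> nat \<Rightarrow>
    (('m, 'n) tangent \<Rightarrow> real) \<Rightarrow> bool" where
  "pos_homogeneous C d f \<longleftrightarrow> (\<forall>\<xi>\<in>C. \<forall>r>0. f (tscale r \<xi>) = r ^ d * f \<xi>)"

text \<open>The same notion for vector- or real-valued functions of the coordinates \<open>(x, y)\<close>.\<close>
definition coord_pos_homogeneous :: "((real ^ 'n::finite) \<times> (real ^ 'n)) set \<Rightarrow> nat \<Rightarrow>
    ((real ^ 'n) \<times> (real ^ 'n) \<Rightarrow> 'b::real_vector) \<Rightarrow> bool" where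
  "coord_pos_homogeneous D d f \<longleftrightarrow>
     (\<forall>z\<in>D. \<forall>r>0. f (fst z, r *\<^sub>R snd z) = r ^ d *\<^sub>R f z)"

text \<open>A function \<open>\<mu>\<close> of the base point alone, smooth on the projection of \<open>C\<close>.\<close>
definition smooth_base_fun :: "('m, 'n::finite) chart set \<Rightarrow> ('m, 'n) tangent set \<Rightarrow>
    ('m \<Rightarrow> real) \<Rightarrow> bool" where
  "smooth_base_fun A C \<mu> \<longleftrightarrow>
     (\<forall>c\<in>A. smooth_on (fst ` coord_dom A C c) (\<lambda>x. \<mu> (chart_inv c x)))"

section \<open>Calculus of a spray in coordinates\<close>

text \<open>\<open>dx k\<close> and \<open>dy k\<close> are the partial derivatives with respect to \<open>x\<^sup>k\<close> and \<open>y\<^sup>k\<close>.\<close>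
definition dx :: "'n::finite \<Rightarrow> ((real ^ 'n) \<times> (real ^ 'n) \<Rightarrow> real) \<Rightarrow>
    (real ^ 'n) \<times> (real ^ 'n) \<Rightarrow> real" where
  "dx k f z = frechet_derivative f (at z) (axis k 1, 0)"

definition dy :: "'n::finite \<Rightarrow> ((real ^ 'n) \<times> (real ^ 'n) \<Rightarrow> real) \<Rightarrow>
    (real ^ 'n) \<times> (real ^ 'n) \<Rightarrow> real" where
  "dy k f z = frechet_derivative f (at z) (0, axis k 1)"

context
  fixes G :: "(real ^ 'n::finite) \<times> (real ^ 'n) \<Rightarrow> real ^ 'n"
begin

abbreviation Gcomp :: "'n \<Rightarrow> (real ^ 'n) \<times> (real ^ 'n) \<Rightarrow> real" where
  "Gcomp i \<equiv> (\<lambda>z. G z $ i)"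

text \<open>\<open>G1 r i\<close> is \<open>G\<^sup>r\<^sub>i\<close>, and \<open>G2 r i j\<close> is \<open>G\<^sup>r\<^sub>i\<^sub>j\<close>.\<close>
definition G1 :: "'n \<Rightarrow> 'n \<Rightarrow> (real ^ 'n) \<times> (real ^ 'n) \<Rightarrow> real" where
  "G1 r i = dy i (Gcomp r)"

definition G2 :: "'n \<Rightarrow> 'n \<Rightarrow> 'n \<Rightarrow> (real ^ 'n) \<times> (real ^ 'n) \<Rightarrow> real" where
  "G2 r i j = dy j (dy i (Gcomp r))"

definition hdelta :: "'n \<Rightarrow> ((real ^ 'n) \<times> (real ^ 'n) \<Rightarrow> real) \<Rightarrow>
    (real ^ 'n) \<times> (real ^ 'n) \<Rightarrow> real" where
  "hdelta i f z = dx i f z - (\<Sum>r\<in>UNIV. G1 r i z * dy r f z)"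

text \<open>\<open>f\<^bsub>;0\<^esub>\<close>\<close>
definition hdelta0 :: "((real ^ 'n) \<times> (real ^ 'n) \<Rightarrow> real) \<Rightarrow>
    (real ^ 'n) \<times> (real ^ 'n) \<Rightarrow> real" where
  "hdelta0 f z = (\<Sum>i\<in>UNIV. hdelta i f z * snd z $ i)"

text \<open>\<open>f\<^bsub>.i;j\<^esub>\<close> and \<open>f\<^bsub>.i;0\<^esub>\<close>\<close>
definition vh_deriv :: "'n \<Rightarrow> 'n \<Rightarrow> ((real ^ 'n) \<times> (real ^ 'n) \<Rightarrow> real) \<Rightarrow>
    (real ^ 'n) \<times> (real ^ 'n) \<Rightarrow> real" where
  "vh_deriv i j f z = hdelta j (dy i f) z - (\<Sum>r\<in>UNIV. dy r f z * G2 r i j z)"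

definition vh_deriv0 :: "'n \<Rightarrow> ((real ^ 'n) \<times> (real ^ 'n) \<Rightarrow> real) \<Rightarrow>
    (real ^ 'n) \<times> (real ^ 'n) \<Rightarrow> real" where
  "vh_deriv0 i f z = (\<Sum>j\<in>UNIV. vh_deriv i j f z * snd z $ j)"

text \<open>\<open>R\<^sup>i\<^sub>k\<close>\<close>
definition riemann :: "'n \<Rightarrow> 'n \<Rightarrow> (real ^ 'n) \<times> (real ^ 'n) \<Rightarrow> real" where
  "riemann i k z =
     2 * dx k (Gcomp i) z
     - (\<Sum>j\<in>UNIV. snd z $ j * dx j (dy k (Gcomp i)) z)
     + 2 * (\<Sum>j\<in>UNIV. Gcomp j z * dy j (dy k (Gcomp i)) z)
     - (\<Sum>j\<in>UNIV. dy j (Gcomp i) z * dy k (Gcomp j) z)"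

end

section \<open>Sprays\<close>

text \<open>The change of induced coordinates on the tangent bundle.\<close>
definition ttransition :: "('m, 'n::finite) chart \<Rightarrow> ('m, 'n) chart \<Rightarrow>
    (real ^ 'n) \<times> (real ^ 'n) \<Rightarrow> (real ^ 'n) \<times> (real ^ 'n)" where
  "ttransition c c' z =
     (transition c c' (fst z), frechet_derivative (transition c c') (at (fst z)) (snd z))"

text \<open>A spray is given by its coefficients \<open>G c\<close> in every chart \<open>c\<close>. The last clause says that the
  local vector fields with components \<open>(y, -2 G c (x, y))\<close> in the induced coordinates
  define one vector field on \<open>C\<close>.\<close>
definition spray :: "('m, 'n::finite) chart set \<Rightarrow> ('m, 'n) tangent set \<Rightarrow>
    (('m, 'n) chart \<Rightarrow> (real ^ 'n) \<times> (real ^ 'n) \<Rightarrow> real ^ 'n) \<Rightarrow> bool" where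
  "spray A C G \<longleftrightarrow>
     (\<forall>c\<in>A. smooth_on (coord_dom A C c) (G c) \<and>
             coord_pos_homogeneous (coord_dom A C c) 2 (G c)) \<and>
     (\<forall>c\<in>A. \<forall>c'\<in>A. \<forall>z\<in>coord_dom A C c. chart_inv c (fst z) \<in> fst c' \<longrightarrow>
        frechet_derivative (ttransition c c') (at z) (snd z, - 2 *\<^sub>R G c z) =
        (snd (ttransition c c' z), - 2 *\<^sub>R G c' (ttransition c c' z)))"

definition hamel_function :: "('m, 'n::finite) chart set \<Rightarrow> ('m, 'n) tangent set \<Rightarrow>
    (('m, 'n) chart \<Rightarrow> (real ^ 'n) \<times> (real ^ 'n) \<Rightarrow> real ^ 'n) \<Rightarrow>
    (('m, 'n) tangent \<Rightarrow> real) \<Rightarrow> bool" where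
  "hamel_function A C G Q \<longleftrightarrow> smooth_fun A C Q \<and> pos_homogeneous C 1 Q \<and>
     (\<forall>c\<in>A. \<forall>z\<in>coord_dom A C c. \<forall>k.
        hdelta (G c) k (coord_expr A c Q) z = vh_deriv0 (G c) k (coord_expr A c Q) z)"

definition funk_function :: "('m, 'n::finite) chart set \<Rightarrow> ('m, 'n) tangent set \<Rightarrow>
    (('m, 'n) chart \<Rightarrow> (real ^ 'n) \<times> (real ^ 'n) \<Rightarrow> real ^ 'n) \<Rightarrow>
    (('m, 'n) tangent \<Rightarrow> real) \<Rightarrow> bool" where
  "funk_function A C G Q \<longleftrightarrow> smooth_fun A C Q \<and> pos_homogeneous C 1 Q \<and>
     (\<forall>c\<in>A. \<forall>z\<in>coord_dom A C c. \<forall>k.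
        hdelta (G c) k (coord_expr A c Q) z =
        coord_expr A c Q z * dy k (coord_expr A c Q) z)"

text \<open>\<open>Gbar\<close> has the coefficients \<open>G + Q\<^bsub>;0\<^esub>/(2Q) y\<close>; for these to make sense on \<open>C\<close>, the function
  \<open>Q\<close> must have no zero there.\<close>
definition associated_spray :: "('m, 'n::finite) chart set \<Rightarrow> ('m, 'n) tangent set \<Rightarrow>
    (('m, 'n) chart \<Rightarrow> (real ^ 'n) \<times> (real ^ 'n) \<Rightarrow> real ^ 'n) \<Rightarrow>
    (('m, 'n) tangent \<Rightarrow> real) \<Rightarrow>
    (('m, 'n) chart \<Rightarrow> (real ^ 'n) \<times> (real ^ 'n) \<Rightarrow> real ^ 'n) \<Rightarrow> bool" where
  "associated_spray A C G Q Gbar \<longleftrightarrow> spray A C Gbar \<and> (\<forall>\<xi>\<in>C. Q \<xi> \<noteq> 0) \<and>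
     (\<forall>c\<in>A. \<forall>z\<in>coord_dom A C c.
        Gbar c z = G c z +
          (hdelta0 (G c) (coord_expr A c Q) z / (2 * coord_expr A c Q z)) *\<^sub>R snd z)"

definition hamel_spray :: "('m, 'n::finite) chart set \<Rightarrow> ('m, 'n) tangent set \<Rightarrow>
    (('m, 'n) chart \<Rightarrow> (real ^ 'n) \<times> (real ^ 'n) \<Rightarrow> real ^ 'n) \<Rightarrow>
    (('m, 'n) tangent \<Rightarrow> real) \<Rightarrow> bool" where
  "hamel_spray A C Gbar Q \<longleftrightarrow>
     (\<exists>G. spray A C G \<and> hamel_function A C G Q \<and> associated_spray A C G Q Gbar)"

definition funk_spray :: "('m, 'n::finite) chart set \<Rightarrow> ('m, 'n) tangent set \<Rightarrow>
    (('m, 'n) chart \<Rightarrow> (real ^ 'n) \<times> (real ^ 'n) \<Rightarrow> real ^ 'n) \<Rightarrow>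
    (('m, 'n) tangent \<Rightarrow> real) \<Rightarrow> bool" where
  "funk_spray A C Gbar Q \<longleftrightarrow>
     (\<exists>G. spray A C G \<and> funk_function A C G Q \<and> associated_spray A C G Q Gbar)"

section \<open>Curvature conditions\<close>

text \<open>\<open>R\<close> is a function on \<open>C\<close>, the \<open>\<tau> c k\<close> are functions of the coordinates in the chart \<open>c\<close>.
  The equation determines \<open>\<tau>\<close> from \<open>R\<close>, because \<open>y \<noteq> 0\<close> on \<open>C\<close>, so the \<open>\<tau> c\<close> need not be
  required separately to be the components of a covector.\<close>
definition scalar_curvature_data :: "('m, 'n::finite) chart set \<Rightarrow> ('m, 'n) tangent set \<Rightarrow>
    (('m, 'n) chart \<Rightarrow> (real ^ 'n) \<times> (real ^ 'n) \<Rightarrow> real ^ 'n) \<Rightarrow>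
    (('m, 'n) tangent \<Rightarrow> real) \<Rightarrow>
    (('m, 'n) chart \<Rightarrow> 'n \<Rightarrow> (real ^ 'n) \<times> (real ^ 'n) \<Rightarrow> real) \<Rightarrow> bool" where
  "scalar_curvature_data A C G R \<tau> \<longleftrightarrow> smooth_fun A C R \<and> pos_homogeneous C 2 R \<and>
     (\<forall>c\<in>A. \<forall>k. smooth_on (coord_dom A C c) (\<tau> c k) \<and>
                 coord_pos_homogeneous (coord_dom A C c) 1 (\<tau> c k)) \<and>
     (\<forall>c\<in>A. \<forall>z\<in>coord_dom A C c. \<forall>i k.
        riemann (G c) i k z =
          coord_expr A c R z * (if i = k then 1 else 0) - \<tau> c k z * snd z $ i)"

definition scalar_curvature :: "('m, 'n::finite) chart set \<Rightarrow> ('m, 'n) tangent set \<Rightarrow>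
    (('m, 'n) chart \<Rightarrow> (real ^ 'n) \<times> (real ^ 'n) \<Rightarrow> real ^ 'n) \<Rightarrow> bool" where
  "scalar_curvature A C G \<longleftrightarrow> (\<exists>R \<tau>. scalar_curvature_data A C G R \<tau>)"

definition isotropic_curvature :: "('m, 'n::finite) chart set \<Rightarrow> ('m, 'n) tangent set \<Rightarrow>
    (('m, 'n) chart \<Rightarrow> (real ^ 'n) \<times> (real ^ 'n) \<Rightarrow> real ^ 'n) \<Rightarrow> bool" where
  "isotropic_curvature A C G \<longleftrightarrow> (\<exists>R \<tau>. scalar_curvature_data A C G R \<tau> \<and>
     (\<forall>c\<in>A. \<forall>z\<in>coord_dom A C c. \<forall>i. dy i (coord_expr A c R) z = 2 * \<tau> c i z))"

text \<open>\<open>R\<^sup>i\<^sub>k = \<lambda> (Q\<^sup>2 \<delta>\<^sup>i\<^sub>k - Q Q\<^bsub>.k\<^esub> y\<^sup>i)\<close>\<close>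
definition curvature_form :: "('m, 'n::finite) chart set \<Rightarrow> ('m, 'n) tangent set \<Rightarrow>
    (('m, 'n) chart \<Rightarrow> (real ^ 'n) \<times> (real ^ 'n) \<Rightarrow> real ^ 'n) \<Rightarrow>
    (('m, 'n) tangent \<Rightarrow> real) \<Rightarrow> (('m, 'n) tangent \<Rightarrow> real) \<Rightarrow> bool" where
  "curvature_form A C G Q l \<longleftrightarrow>
     (\<forall>c\<in>A. \<forall>z\<in>coord_dom A C c. \<forall>i k.
        riemann (G c) i k z =
          coord_expr A c l z *
            ((coord_expr A c Q z)\<^sup>2 * (if i = k then 1 else 0)
             - coord_expr A c Q z * dy k (coord_expr A c Q) z * snd z $ i))"

text \<open>\<open>l\<close> depends only on the base point as long as \<open>y\<close> stays in one connected component of the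
  fibre of \<open>C\<close>. For connected fibres this means that \<open>l\<close> is a function of \<open>x\<close>; otherwise the
  values on different components of one fibre may differ, as the curvature condition on one
  component does not see the others.\<close>
definition locally_base_fun :: "('m, 'n::finite) chart set \<Rightarrow> ('m, 'n) tangent set \<Rightarrow>
    (('m, 'n) tangent \<Rightarrow> real) \<Rightarrow> bool" where
  "locally_base_fun A C l \<longleftrightarrow>
     (\<forall>c\<in>A. \<forall>x\<in>chart_image c. \<forall>y y'. connected_component (coord_fibre A C c x) y y' \<longrightarrow>
        coord_expr A c l (x, y) = coord_expr A c l (x, y'))"

end

theory Submission
  imports Defs
begin

text \<open>
  Both parts rest on one fact: with respect to a Hamel spray \<open>H\<close> associated to \<open>(G, Q)\<close>, the
  adjoint function \<open>Q\<close> is horizontally constant, \<open>\<delta>\<^sub>k Q = 0\<close> (lemma \<open>hdelta_associated_eq_0\<close>).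
  Since \<open>Q\<^bsub>.k;0\<^esub> = (Q\<^bsub>;0\<^esub>)\<^bsub>.k\<^esub> - Q\<^bsub>;k\<^esub>\<close>, the Hamel equation of \<open>Q\<close> says \<open>(Q\<^bsub>;0\<^esub>)\<^bsub>.k\<^esub> = 2 Q\<^bsub>;k\<^esub>\<close>.
  Adding \<open>P y\<close> to \<open>G\<close> lowers \<open>Q\<^bsub>;k\<^esub>\<close> by \<open>(P Q)\<^bsub>.k\<^esub>\<close>, and for \<open>P = Q\<^bsub>;0\<^esub>/(2Q)\<close> this is
  \<open>(Q\<^bsub>;0\<^esub>)\<^bsub>.k\<^esub>/2 = Q\<^bsub>;k\<^esub>\<close>. A Funk function is a Hamel function, so the fact covers Funk sprays too.

  Differentiating \<open>\<delta>\<^sub>k Q = 0\<close> along the spray gives \<open>R\<^sup>i\<^sub>k Q\<^bsub>.i\<^esub> = 0\<close> (lemma \<open>riemann_annihilates\<close>).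
  If \<open>R\<^sup>i\<^sub>k = R \<delta>\<^sup>i\<^sub>k - \<tau>\<^sub>k y\<^sup>i\<close>, contraction with \<open>Q\<^bsub>.i\<^esub>\<close> and Euler's relation
  \<open>y\<^sup>i Q\<^bsub>.i\<^esub> = Q\<close> yield \<open>R Q\<^bsub>.k\<^esub> = \<tau>\<^sub>k Q\<close>, so the curvature has the form
  \<open>\<lambda> (Q\<^sup>2 \<delta>\<^sup>i\<^sub>k - Q Q\<^bsub>.k\<^esub> y\<^sup>i)\<close> with \<open>\<lambda> = R/Q\<^sup>2\<close>.
  Conversely, this form exhibits \<open>R = \<lambda> Q\<^sup>2\<close> and \<open>\<tau>\<^sub>k = \<lambda> Q Q\<^bsub>.k\<^esub>\<close>. These must be homogeneous,
  hence \<open>\<lambda>\<close> must be homogeneous of degree 0. In dimension \<open>n \<ge> 2\<close> this follows from the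
  trace \<open>R\<^sup>i\<^sub>i = (n - 1) \<lambda> Q\<^sup>2\<close>. In dimension 1 the form vanishes by Euler's
  relation, and \<open>\<lambda>\<close> can be replaced by 0.

  With \<open>R = \<lambda> Q\<^sup>2\<close> and \<open>\<tau>\<^sub>k = \<lambda> Q Q\<^bsub>.k\<^esub>\<close> one has \<open>R\<^bsub>.k\<^esub> - 2 \<tau>\<^sub>k = \<lambda>\<^bsub>.k\<^esub> Q\<^sup>2\<close>. Hence isotropy
  means \<open>\<lambda>\<^bsub>.k\<^esub> = 0\<close>, that is, \<open>\<lambda>\<close> is constant on the connected components of each fibre. If the
  fibres are connected, \<open>\<lambda>\<close> descends to a function of the base point
  (lemma \<open>locally_base_fun_descends\<close>).
\<close>

section \<open>Directional derivatives and smooth functions\<close>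

text \<open>The partial derivatives in the variables \<open>x\<close> and \<open>y\<close> are instances for the coordinate directions, so that
  each differentiation rule is proved once for all of them.\<close>
definition dirder :: "'a \<Rightarrow> ('a::real_normed_vector \<Rightarrow> 'b::real_normed_vector) \<Rightarrow> 'a \<Rightarrow> 'b" where
  "dirder v f z = frechet_derivative f (at z) v"

lemma Ck_on_Suc_iff:
  "Ck_on (Suc k) S f \<longleftrightarrow> (\<forall>z\<in>S. f differentiable (at z)) \<and> (\<forall>v. Ck_on k S (dirder v f))"
  by (simp add: dirder_def[abs_def])

declare Ck_on.simps(2)[simp del]

lemma dirder_eq: "(f has_derivative f') (at z) \<Longrightarrow> dirder v f z = f' v"
  unfolding dirder_def by (simp add: frechet_derivative_at[symmetric])

lemma has_derivative_dirder:
  "f differentiable (at z) \<Longrightarrow> (f has_derivative (\<lambda>v. dirder v f z)) (at z)"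
  unfolding dirder_def by (simp add: frechet_derivative_works[symmetric])

text \<open>If one of the two functions is not differentiable at \<open>z\<close>, then neither is, and
  \<open>frechet_derivative\<close> picks the same arbitrary value for both.\<close>
lemma dirder_cong:
  assumes "open U" "z \<in> U" "\<And>w. w \<in> U \<Longrightarrow> f w = g w"
  shows "dirder v f z = dirder v g z"
proof (cases "f differentiable (at z)")
  case True
  then show ?thesis
    unfolding dirder_def using frechet_derivative_transform_within_open assms by metis
next
  case False
  then have n: "\<not> (f has_derivative F) (at z)" for F
    unfolding differentiable_def by blast
  have "\<not> (g has_derivative F) (at z)" for F
  proof
    assume "(g has_derivative F) (at z)"
    then have "(f has_derivative F) (at z)"
      by (rule has_derivative_transform_within_open[OF _ assms(1,2)]) (simp add: assms(3))
    with n show False by blast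
  qed
  with n show ?thesis unfolding dirder_def frechet_derivative_def by simp
qed

lemma dirder_add:
  assumes "f differentiable (at z)" "g differentiable (at z)"
  shows "dirder v (\<lambda>w. f w + g w) z = dirder v f z + dirder v g z"
  by (rule dirder_eq[OF has_derivative_add[OF has_derivative_dirder[OF assms(1)] has_derivative_dirder[OF assms(2)]]])

lemma dirder_mult:
  fixes f g :: "_ \<Rightarrow> real"
  assumes "f differentiable (at z)" "g differentiable (at z)"
  shows "dirder v (\<lambda>w. f w * g w) z = dirder v f z * g z + f z * dirder v g z"
  using dirder_eq[OF has_derivative_mult[OF has_derivative_dirder[OF assms(1)] has_derivative_dirder[OF assms(2)]]]
  by (simp add: algebra_simps)

lemma dirder_inverse:
  fixes f :: "_ \<Rightarrow> real"
  assumes "f differentiable (at z)" "f z \<noteq> 0"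
  shows "dirder v (\<lambda>w. inverse (f w)) z = - 1 * (dirder v f z * (inverse (f z) * inverse (f z)))"
  using dirder_eq[OF Deriv.has_derivative_inverse[OF assms(2) has_derivative_dirder[OF assms(1)]]]
  by (simp add: algebra_simps)

lemma dirder_const: "dirder v (\<lambda>w. c) z = 0"
  by (rule dirder_eq) simp

lemma dirder_linear_compose:
  assumes "bounded_linear L" "f differentiable (at z)"
  shows "dirder v (\<lambda>w. L (f w)) z = L (dirder v f z)"
  by (rule dirder_eq[OF bounded_linear.has_derivative[OF assms(1) has_derivative_dirder[OF assms(2)]]])

lemma affine_has_derivative:
  assumes "bounded_linear L"
  shows "((\<lambda>w. L w + b) has_derivative L) (at z)"
  using has_derivative_add[OF bounded_linear_imp_has_derivative[OF assms] has_derivative_const[of b]] by simp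

lemma dirder_affine:
  assumes "bounded_linear L" "f differentiable (at (L z + b))"
  shows "dirder v (\<lambda>w. f (L w + b)) z = dirder (L v) f (L z + b)"
  using dirder_eq[OF has_derivative_compose[OF affine_has_derivative[OF assms(1)] has_derivative_dirder[OF assms(2)]]] 
  .

lemma Ck_on_cong:
  assumes "open S" "\<And>w. w \<in> S \<Longrightarrow> f w = g w"
  shows "Ck_on k S f = Ck_on k S g"
  using assms(2)
proof (induction k arbitrary: f g)
  case 0
  then show ?case by (simp cong: continuous_on_cong)
next
  case (Suc k)
  have "f differentiable (at z) \<longleftrightarrow> g differentiable (at z)" if "z \<in> S" for z
    unfolding differentiable_def
    by (metis assms(1) has_derivative_transform_within_open Suc.prems that)
  moreover have "Ck_on k S (dirder v f) = Ck_on k S (dirder v g)" for v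
    by (rule Suc.IH) (rule dirder_cong[OF assms(1)], auto simp: Suc.prems)
  ultimately show ?case unfolding Ck_on_Suc_iff by simp
qed

text \<open>Differentiability is a condition at each point, so induction reduces the claim to continuity.\<close>
lemma Ck_on_local:
  assumes "\<And>z. z \<in> S \<Longrightarrow> \<exists>U. open U \<and> z \<in> U \<and> Ck_on k U f"
  shows "Ck_on k S f"
  using assms
proof (induction k arbitrary: f)
  case 0
  then have "\<exists>U. open U \<and> z \<in> U \<and> continuous_on U f" if "z \<in> S" for z using that by simp
  then have "isCont f z" if "z \<in> S" for z using that
    by (metis continuous_on_eq_continuous_at)
  then show ?case by (simp add: continuous_at_imp_continuous_on)
next
  case (Suc k)
  then show ?case unfolding Ck_on_Suc_iff by meson
qed

lemma Ck_on_Suc_imp: "Ck_on (Suc k) S f \<Longrightarrow> Ck_on k S f"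
proof (induction k arbitrary: f)
  case 0
  then show ?case
    by (auto simp: Ck_on_Suc_iff intro!: continuous_at_imp_continuous_on differentiable_imp_continuous_within)
next
  case (Suc k)
  then show ?case by (auto simp: Ck_on_Suc_iff)
qed

lemma Ck_on_const: "Ck_on k S (\<lambda>w. c)"
proof (induction k arbitrary: c)
  case (Suc k)
  then show ?case by (simp add: Ck_on_Suc_iff dirder_const[abs_def])
qed simp

lemma Ck_on_add:
  assumes "open S" "Ck_on k S f" "Ck_on k S g"
  shows "Ck_on k S (\<lambda>w. f w + g w)"
  using assms(2,3)
proof (induction k arbitrary: f g)
  case 0
  then show ?case by (simp add: continuous_on_add)
next
  case (Suc k)
  have "Ck_on k S (dirder v (\<lambda>w. f w + g w)) = Ck_on k S (\<lambda>z. dirder v f z + dirder v g z)" for v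
    by (rule Ck_on_cong[OF assms(1)], rule dirder_add) (use Suc.prems in \<open>auto simp: Ck_on_Suc_iff\<close>)
  then show ?case using Suc by (auto simp: Ck_on_Suc_iff)
qed

lemma Ck_on_mult:
  fixes f g :: "_ \<Rightarrow> real"
  assumes "open S" "Ck_on k S f" "Ck_on k S g"
  shows "Ck_on k S (\<lambda>w. f w * g w)"
  using assms(2,3)
proof (induction k arbitrary: f g)
  case 0
  then show ?case by (simp add: continuous_on_mult)
next
  case (Suc k)
  have fg: "Ck_on k S f" "Ck_on k S g" using Suc.prems Ck_on_Suc_imp by auto
  have "Ck_on k S (dirder v (\<lambda>w. f w * g w)) = Ck_on k S (\<lambda>z. dirder v f z * g z + f z * dirder v g z)" for v
    by (rule Ck_on_cong[OF assms(1)], rule dirder_mult) (use Suc.prems in \<open>auto simp: Ck_on_Suc_iff\<close>)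
  moreover have "Ck_on k S (\<lambda>z. dirder v f z * g z + f z * dirder v g z)" for v
    using Suc.prems fg by (intro Ck_on_add Suc.IH assms(1)) (auto simp: Ck_on_Suc_iff)
  ultimately show ?case using Suc.prems by (auto simp: Ck_on_Suc_iff)
qed

lemma Ck_on_inverse:
  fixes f :: "_ \<Rightarrow> real"
  assumes "open S" "Ck_on k S f" "\<And>z. z \<in> S \<Longrightarrow> f z \<noteq> 0"
  shows "Ck_on k S (\<lambda>w. inverse (f w))"
  using assms(2)
proof (induction k)
  case 0
  then show ?case using assms(3) by (simp add: continuous_on_inverse)
next
  case (Suc k)
  have i: "Ck_on k S (\<lambda>w. inverse (f w))" using Suc Ck_on_Suc_imp by blast
  have "Ck_on k S (dirder v (\<lambda>w. inverse (f w)))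
      = Ck_on k S (\<lambda>z. - 1 * (dirder v f z * (inverse (f z) * inverse (f z))))" for v
    by (rule Ck_on_cong[OF assms(1)], rule dirder_inverse) (use Suc.prems assms(3) in \<open>auto simp: Ck_on_Suc_iff\<close>)
  moreover have "Ck_on k S (\<lambda>z. - 1 * (dirder v f z * (inverse (f z) * inverse (f z))))" for v
    using Suc.prems by (intro Ck_on_mult Ck_on_const i assms(1)) (auto simp: Ck_on_Suc_iff)
  ultimately show ?case using Suc.prems assms(3) by (auto simp: Ck_on_Suc_iff)
qed

lemma Ck_on_linear_compose:
  assumes "open S" "bounded_linear L" "Ck_on k S f"
  shows "Ck_on k S (\<lambda>w. L (f w))"
  using assms(3)
proof (induction k arbitrary: f)
  case 0
  then show ?case using assms(2) by (simp add: bounded_linear.continuous_on)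
next
  case (Suc k)
  have "Ck_on k S (dirder v (\<lambda>w. L (f w))) = Ck_on k S (\<lambda>z. L (dirder v f z))" for v
    by (rule Ck_on_cong[OF assms(1)], rule dirder_linear_compose[OF assms(2)])
      (use Suc.prems in \<open>auto simp: Ck_on_Suc_iff\<close>)
  moreover have "(\<lambda>w. L (f w)) differentiable (at z)" if "z \<in> S" for z
    using bounded_linear.has_derivative[OF assms(2) has_derivative_dirder[of f z]] Suc.prems that
    unfolding differentiable_def Ck_on_Suc_iff by blast
  ultimately show ?case using Suc by (auto simp: Ck_on_Suc_iff)
qed

lemma Ck_on_affine_compose:
  assumes "open T" "bounded_linear L" "Ck_on k S f" "\<And>w. w \<in> T \<Longrightarrow> L w + b \<in> S"
  shows "Ck_on k T (\<lambda>w. f (L w + b))"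
  using assms(3)
proof (induction k arbitrary: f)
  case 0
  have "continuous_on T (\<lambda>w. L w + b)"
    by (intro continuous_intros bounded_linear.continuous_on[OF assms(2)])
  then show ?case using 0 assms(4) by (auto intro: continuous_on_compose2)
next
  case (Suc k)
  have "Ck_on k T (dirder v (\<lambda>w. f (L w + b))) = Ck_on k T (\<lambda>z. dirder (L v) f (L z + b))" for v
    by (rule Ck_on_cong[OF assms(1)], rule dirder_affine[OF assms(2)])
      (use Suc.prems assms(4) in \<open>auto simp: Ck_on_Suc_iff\<close>)
  moreover have "(\<lambda>w. f (L w + b)) differentiable (at z)" if "z \<in> T" for z
  proof -
    have "f differentiable (at (L z + b))" using Suc.prems assms(4) that by (auto simp: Ck_on_Suc_iff)
    from has_derivative_compose[OF affine_has_derivative[OF assms(2)] has_derivative_dirder[OF this]]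
    show ?thesis unfolding differentiable_def by blast
  qed
  ultimately show ?case using Suc by (auto simp: Ck_on_Suc_iff)
qed

lemma smooth_on_differentiable: "smooth_on S f \<Longrightarrow> z \<in> S \<Longrightarrow> f differentiable (at z)"
  unfolding smooth_on_def using Ck_on_Suc_iff by blast

lemma smooth_on_dirder: "smooth_on S f \<Longrightarrow> smooth_on S (dirder v f)"
  unfolding smooth_on_def using Ck_on_Suc_iff by blast

lemma smooth_on_continuous: "smooth_on S f \<Longrightarrow> continuous_on S f"
  unfolding smooth_on_def using Ck_on.simps(1) by blast

lemma smooth_on_cong:
  "open S \<Longrightarrow> (\<And>w. w \<in> S \<Longrightarrow> f w = g w) \<Longrightarrow> smooth_on S f = smooth_on S g"
  unfolding smooth_on_def using Ck_on_cong by blast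

lemma smooth_on_local:
  "(\<And>z. z \<in> S \<Longrightarrow> \<exists>U. open U \<and> z \<in> U \<and> smooth_on U f) \<Longrightarrow> smooth_on S f"
  unfolding smooth_on_def by (meson Ck_on_local)

lemma smooth_on_const: "smooth_on S (\<lambda>w. c)"
  unfolding smooth_on_def using Ck_on_const by blast

lemma smooth_on_add:
  "open S \<Longrightarrow> smooth_on S f \<Longrightarrow> smooth_on S g \<Longrightarrow> smooth_on S (\<lambda>w. f w + g w)"
  unfolding smooth_on_def using Ck_on_add by blast

lemma smooth_on_sum:
  assumes "open S" "\<And>i. i \<in> I \<Longrightarrow> smooth_on S (f i)"
  shows "smooth_on S (\<lambda>w. \<Sum>i\<in>I. f i w)"
  using assms(2)
  by (induction I rule: infinite_finite_induct) (simp_all add: smooth_on_const smooth_on_add[OF assms(1)])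

lemma smooth_on_mult:
  fixes f g :: "_ \<Rightarrow> real"
  shows "open S \<Longrightarrow> smooth_on S f \<Longrightarrow> smooth_on S g \<Longrightarrow> smooth_on S (\<lambda>w. f w * g w)"
  unfolding smooth_on_def using Ck_on_mult by blast

lemma smooth_on_minus:
  fixes f :: "_ \<Rightarrow> real"
  shows "open S \<Longrightarrow> smooth_on S f \<Longrightarrow> smooth_on S (\<lambda>w. - f w)"
  using smooth_on_mult[of S "\<lambda>_. - 1" f] smooth_on_const[of S "- 1 :: real"] by simp

lemma smooth_on_diff:
  fixes f g :: "_ \<Rightarrow> real"
  shows "open S \<Longrightarrow> smooth_on S f \<Longrightarrow> smooth_on S g \<Longrightarrow> smooth_on S (\<lambda>w. f w - g w)"
  using smooth_on_add[of S f "\<lambda>w. - g w"] smooth_on_minus by auto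

lemma smooth_on_divide:
  fixes f g :: "_ \<Rightarrow> real"
  shows "open S \<Longrightarrow> smooth_on S f \<Longrightarrow> smooth_on S g \<Longrightarrow> (\<And>z. z \<in> S \<Longrightarrow> g z \<noteq> 0)
    \<Longrightarrow> smooth_on S (\<lambda>w. f w / g w)"
  using smooth_on_mult[of S f "\<lambda>w. inverse (g w)"] Ck_on_inverse[of S _ g]
  unfolding smooth_on_def divide_inverse by blast

lemma smooth_on_linear_compose:
  "open S \<Longrightarrow> bounded_linear L \<Longrightarrow> smooth_on S f \<Longrightarrow> smooth_on S (\<lambda>w. L (f w))"
  unfolding smooth_on_def using Ck_on_linear_compose by blast

lemma smooth_on_affine_compose:
  "open T \<Longrightarrow> bounded_linear L \<Longrightarrow> smooth_on S f \<Longrightarrow> (\<And>w. w \<in> T \<Longrightarrow> L w + b \<in> S)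
    \<Longrightarrow> smooth_on T (\<lambda>w. f (L w + b))"
  unfolding smooth_on_def using Ck_on_affine_compose by blast

lemma smooth_on_id: "smooth_on S (\<lambda>w. w)"
proof -
  have "dirder v (\<lambda>w::'a. w) = (\<lambda>_. v)" for v
    by (rule ext, rule dirder_eq) simp
  then have "Ck_on (Suc k) S (\<lambda>w. w)" for k
    by (simp add: Ck_on_Suc_iff Ck_on_const)
  then show ?thesis unfolding smooth_on_def using Ck_on_Suc_imp by blast
qed

section \<open>Symmetry of second derivatives\<close>

text \<open>One mean value theorem in the direction \<open>u\<close>, applied to the increment of \<open>f\<close> along \<open>h v\<close>, and a
  second one in the direction \<open>v\<close>. The left-hand side is symmetric in \<open>u\<close> and \<open>v\<close>, which makes the
  mixed second derivatives commute.\<close>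
lemma second_difference_mvt:
  fixes f :: "'a::real_normed_vector \<Rightarrow> real"
  assumes f: "\<And>w. w \<in> ball z e \<Longrightarrow> f differentiable (at w)"
    and fu: "\<And>w. w \<in> ball z e \<Longrightarrow> dirder u f differentiable (at w)"
    and h: "0 < h" "h * (norm u + norm v) < e"
  shows "\<exists>w\<in>ball z e. f (z + h *\<^sub>R u + h *\<^sub>R v) - f (z + h *\<^sub>R u) - f (z + h *\<^sub>R v) + f z
           = h * h * dirder v (dirder u f) w"
proof -
  have inb: "z + s *\<^sub>R u + t *\<^sub>R v \<in> ball z e" if "0 \<le> s" "s \<le> h" "0 \<le> t" "t \<le> h" for s t
  proof -
    have "norm (s *\<^sub>R u + t *\<^sub>R v) \<le> s * norm u + t * norm v"
      using norm_triangle_ineq[of "s *\<^sub>R u" "t *\<^sub>R v"] that by simp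
    also have "\<dots> \<le> h * norm u + h * norm v"
      using that by (intro add_mono mult_right_mono) auto
    finally have "norm (s *\<^sub>R u + t *\<^sub>R v) < e" using h by (simp add: distrib_left)
    moreover have "dist z (z + s *\<^sub>R u + t *\<^sub>R v) = norm (s *\<^sub>R u + t *\<^sub>R v)"
      by (metis add.assoc add_diff_cancel_left' dist_commute dist_norm)
    ultimately show ?thesis by simp
  qed
  have line: "((\<lambda>s. F (z + s *\<^sub>R a + c)) has_real_derivative dirder a F (z + s *\<^sub>R a + c)) (at s)"
    if "F differentiable (at (z + s *\<^sub>R a + c))" for F :: "'a \<Rightarrow> real" and a c s
  proof -
    have "((\<lambda>s. z + s *\<^sub>R a + c) has_derivative (\<lambda>t. t *\<^sub>R a)) (at s)"
      by (auto intro!: derivative_eq_intros)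
    from has_derivative_compose[OF this has_derivative_dirder[OF that]]
    have "((\<lambda>s. F (z + s *\<^sub>R a + c)) has_derivative (\<lambda>t. dirder (t *\<^sub>R a) F (z + s *\<^sub>R a + c))) (at s)" .
    moreover have "(\<lambda>t. dirder (t *\<^sub>R a) F (z + s *\<^sub>R a + c)) = (*) (dirder a F (z + s *\<^sub>R a + c))"
      using linear_scale[OF has_derivative_linear[OF has_derivative_dirder[OF that]], of _ a] by auto
    ultimately show ?thesis unfolding has_field_derivative_def by simp
  qed
  let ?g = "\<lambda>s. f (z + s *\<^sub>R u + h *\<^sub>R v) - f (z + s *\<^sub>R u + 0)"
  let ?g' = "\<lambda>s. dirder u f (z + s *\<^sub>R u + h *\<^sub>R v) - dirder u f (z + s *\<^sub>R u + 0)"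
  have "(?g has_real_derivative ?g' s) (at s)" if "0 \<le> s" "s \<le> h" for s
    using inb[OF that, of h] inb[OF that, of 0] h
    by (intro DERIV_diff line f) auto
  from MVT2[OF h(1) this] obtain s where s: "0 < s" "s < h" "?g h - ?g 0 = (h - 0) * ?g' s"
    by auto
  let ?k = "\<lambda>t. dirder u f (z + t *\<^sub>R v + s *\<^sub>R u)"
  have "(?k has_real_derivative dirder v (dirder u f) (z + t *\<^sub>R v + s *\<^sub>R u)) (at t)"
    if "0 \<le> t" "t \<le> h" for t
    using inb[of s t] that s
    by (intro line fu) (auto simp: add_ac)
  from MVT2[OF h(1) this] obtain t where t: "0 < t" "t < h"
    "?k h - ?k 0 = (h - 0) * dirder v (dirder u f) (z + t *\<^sub>R v + s *\<^sub>R u)"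
    by auto
  have "z + t *\<^sub>R v + s *\<^sub>R u \<in> ball z e" using inb[of s t] s t by (simp add: add_ac)
  moreover have "f (z + h *\<^sub>R u + h *\<^sub>R v) - f (z + h *\<^sub>R u) - f (z + h *\<^sub>R v) + f z
           = h * h * dirder v (dirder u f) (z + t *\<^sub>R v + s *\<^sub>R u)"
    using s(3) t(3) by (simp add: add_ac)
  ultimately show ?thesis by blast
qed

text \<open>If the two mixed derivatives differed at \<open>z\<close>, they would by continuity take disjoint sets of values
  on a small ball around \<open>z\<close>, but \<open>second_difference_mvt\<close> yields points of the ball where they agree.\<close>
lemma dirder_commute:
  fixes f :: "'a::real_normed_vector \<Rightarrow> real"
  assumes "open S" "smooth_on S f" "z \<in> S"
  shows "dirder v (dirder u f) z = dirder u (dirder v f) z"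
proof (rule ccontr)
  let ?P = "dirder v (dirder u f)" and ?R = "dirder u (dirder v f)"
  assume ne: "?P z \<noteq> ?R z"
  \<comment> \<open>half the difference, so that the two \<open>d\<close>-balls of values are disjoint\<close>
  define d where "d = \<bar>?P z - ?R z\<bar> / 2"
  have d: "d > 0" using ne by (simp add: d_def)
  have c: "isCont (dirder a (dirder b f)) z" for a b
    using smooth_on_continuous[OF smooth_on_dirder[OF smooth_on_dirder[OF assms(2)]]] assms(1,3)
    by (simp add: continuous_on_eq_continuous_at)
  obtain d1 where d1: "d1 > 0" "\<And>w. dist w z < d1 \<Longrightarrow> dist (?P w) (?P z) < d"
    using c[of v u, unfolded continuous_at_eps_delta] d by blast
  obtain d2 where d2: "d2 > 0" "\<And>w. dist w z < d2 \<Longrightarrow> dist (?R w) (?R z) < d"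
    using c[of u v, unfolded continuous_at_eps_delta] d by blast
  obtain d3 where d3: "d3 > 0" "ball z d3 \<subseteq> S" using assms(1,3) by (rule openE)
  define e where "e = min d1 (min d2 d3)"
  have e: "e > 0" "ball z e \<subseteq> S" using d1(1) d2(1) d3 by (auto simp: e_def)
  \<comment> \<open>the summand 1 keeps the denominator positive when \<open>u = v = 0\<close>\<close>
  define h where "h = e / (norm u + norm v + 1)"
  have np: "norm u + norm v + 1 > 0" by (smt (verit) norm_ge_zero)
  have h: "h > 0" "h * (norm u + norm v) < e" "h * (norm v + norm u) < e"
    using e np by (auto simp: h_def field_simps)
  have dif: "f differentiable (at w)" "dirder a f differentiable (at w)" if "w \<in> ball z e" for w a
    using assms(2) e that smooth_on_differentiable smooth_on_dirder by blast+
  obtain w1 where w1: "w1 \<in> ball z e" "f (z + h *\<^sub>R u + h *\<^sub>R v) - f (z + h *\<^sub>R u) - f (z + h *\<^sub>R v) + f z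
           = h * h * ?P w1"
    using second_difference_mvt[OF dif h(1,2)] by blast
  obtain w2 where w2: "w2 \<in> ball z e" "f (z + h *\<^sub>R v + h *\<^sub>R u) - f (z + h *\<^sub>R v) - f (z + h *\<^sub>R u) + f z
           = h * h * ?R w2"
    using second_difference_mvt[OF dif h(1,3)] by blast
  have swap: "z + h *\<^sub>R v + h *\<^sub>R u = z + h *\<^sub>R u + h *\<^sub>R v" by (simp add: add_ac)
  have "h * h * ?P w1 = h * h * ?R w2" using w1(2) w2(2)[unfolded swap] by linarith
  then have "?P w1 = ?R w2" using h by simp
  moreover have "dist (?P w1) (?P z) < d" "dist (?R w2) (?R z) < d"
    using d1(2)[of w1] d2(2)[of w2] w1(1) w2(1) by (auto simp: e_def dist_commute)
  ultimately show False unfolding d_def dist_real_def by (smt (verit) field_sum_of_halves)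
qed

section \<open>Partial derivatives and homogeneous functions\<close>

lemma dx_eq_dirder: "dx k = dirder (axis k 1, 0)"
  by (intro ext) (simp add: dx_def dirder_def)

lemma dy_eq_dirder: "dy k = dirder (0, axis k 1)"
  by (intro ext) (simp add: dy_def dirder_def)

lemma dirder_diff:
  fixes f g :: "_ \<Rightarrow> real"
  assumes "f differentiable (at z)" "g differentiable (at z)"
  shows "dirder v (\<lambda>w. f w - g w) z = dirder v f z - dirder v g z"
  by (rule dirder_eq[OF has_derivative_diff[OF has_derivative_dirder[OF assms(1)] has_derivative_dirder[OF assms(2)]]])

lemma dirder_cmult:
  fixes f :: "_ \<Rightarrow> real"
  assumes "f differentiable (at z)"
  shows "dirder v (\<lambda>w. c * f w) z = c * dirder v f z"
  using dirder_mult[OF differentiable_const assms, of v c] by (simp add: dirder_const)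

lemma dirder_sum_mult:
  fixes f g :: "_ \<Rightarrow> _ \<Rightarrow> real"
  assumes "\<And>i. f i differentiable (at z)" "\<And>i. g i differentiable (at z)"
  shows "dirder v (\<lambda>w. \<Sum>i\<in>I. f i w * g i w) z
    = (\<Sum>i\<in>I. dirder v (f i) z * g i z) + (\<Sum>i\<in>I. f i z * dirder v (g i) z)"
proof -
  have "((\<lambda>w. \<Sum>i\<in>I. f i w * g i w) has_derivative
     (\<lambda>v. \<Sum>i\<in>I. f i z * dirder v (g i) z + dirder v (f i) z * g i z)) (at z)"
    by (intro has_derivative_sum has_derivative_mult has_derivative_dirder assms)
  from dirder_eq[OF this] show ?thesis by (simp add: sum.distrib add.commute)
qed

lemma dirder_linear:
  assumes "f differentiable (at z)"
  shows "linear (\<lambda>v. dirder v f z)"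
  using has_derivative_linear[OF has_derivative_dirder[OF assms]] .

lemma dirder_eq_sum_partials:
  fixes f :: "(real ^ 'n::finite) \<times> (real ^ 'n) \<Rightarrow> real"
  assumes "f differentiable (at z)"
  shows "dirder (a, b) f z = (\<Sum>j\<in>UNIV. a $ j * dx j f z) + (\<Sum>j\<in>UNIV. b $ j * dy j f z)"
proof -
  note lin = dirder_linear[OF assms]
  have exp: "c = (\<Sum>j\<in>UNIV. c $ j *\<^sub>R axis j 1)" for c :: "real ^ 'n"
    using basis_expansion[of c] by (simp add: scalar_mult_eq_scaleR)
  have l1: "linear (\<lambda>a. dirder (a, 0) f z)" and l2: "linear (\<lambda>b. dirder (0, b) f z)"
    using linear_compose[OF _ lin, of "\<lambda>a. (a, 0)"] linear_compose[OF _ lin, of "\<lambda>b. (0, b)"]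
    by (simp_all add: o_def linear_iff)
  have "dirder (a, b) f z = dirder ((a, 0) + (0, b)) f z" by simp
  also have "\<dots> = dirder (a, 0) f z + dirder (0, b) f z" by (rule linear_add[OF lin])
  also have "dirder (a, 0) f z = (\<Sum>j\<in>UNIV. a $ j * dx j f z)"
    by (subst exp[of a]) (simp add: linear_sum[OF l1] linear_scale[OF l1] dx_eq_dirder)
  also have "dirder (0, b) f z = (\<Sum>j\<in>UNIV. b $ j * dy j f z)"
    by (subst exp[of b]) (simp add: linear_sum[OF l2] linear_scale[OF l2] dy_eq_dirder)
  finally show ?thesis .
qed

lemma bounded_linear_snd_nth: "bounded_linear (\<lambda>w::'a::real_normed_vector \<times> (real ^ 'n::finite). snd w $ j)"
  using bounded_linear_compose[OF bounded_linear_vec_nth bounded_linear_snd] .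

lemma smooth_on_snd_nth: "open S \<Longrightarrow> smooth_on S (\<lambda>w::'a::real_normed_vector \<times> (real ^ 'n::finite). snd w $ j)"
  using smooth_on_linear_compose[OF _ bounded_linear_snd_nth smooth_on_id] .

lemma dirder_snd_nth: "dirder v (\<lambda>w::'a::real_normed_vector \<times> (real ^ 'n::finite). snd w $ j) z = snd v $ j"
  by (rule dirder_eq) (rule bounded_linear_imp_has_derivative[OF bounded_linear_snd_nth])

lemma has_derivative_fibre:
  assumes "f differentiable (at (x, y))"
  shows "((\<lambda>y. f (x, y)) has_derivative (\<lambda>b. dirder (0, b) f (x, y))) (at y)"
proof -
  have "((\<lambda>y. (x, y)) has_derivative (\<lambda>b. (0, b))) (at y)"
    by (auto intro!: derivative_eq_intros)
  from has_derivative_compose[OF this has_derivative_dirder[OF assms]] show ?thesis .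
qed

text \<open>The vertical derivative of \<open>f\<close> is the derivative of its restriction to a fibre. The fibres of an
  open set are open, and so are their components.\<close>
lemma locally_constant_on_fibres_iff:
  fixes D :: "((real ^ 'n::finite) \<times> (real ^ 'n)) set"
  assumes D: "open D" and f: "smooth_on D f"
  shows "(\<forall>x y y'. connected_component {y. (x, y) \<in> D} y y' \<longrightarrow> f (x, y) = f (x, y'))
     \<longleftrightarrow> (\<forall>z\<in>D. \<forall>i. dy i f z = 0)"
proof -
  have fib: "open {y. (x, y) \<in> D}" for x
    using open_vimage[OF D, of "\<lambda>y. (x, y)"] by (simp add: vimage_def continuous_on_Pair)
  note der = has_derivative_fibre[OF smooth_on_differentiable[OF f]]
  show ?thesis
  proof (intro iffI ballI allI impI)
    fix z i
    assume const: "\<forall>x y y'. connected_component {y. (x, y) \<in> D} y y' \<longrightarrow> f (x, y) = f (x, y')"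
      and "z \<in> D"
    then obtain x y where z: "z = (x, y)" "(x, y) \<in> D" by (cases z) auto
    then obtain e where e: "e > 0" "ball y e \<subseteq> {y. (x, y) \<in> D}"
      using openE[OF fib, of y x] by auto
    have "f (x, y) = f (x, y')" if "y' \<in> ball y e" for y'
      using const e that unfolding connected_component_def
      by (meson centre_in_ball connected_ball)
    then have "((\<lambda>y. f (x, y)) has_derivative (\<lambda>b. 0)) (at y)"
      by (intro has_derivative_transform_within_open[OF has_derivative_const[of "f (x, y)"] open_ball, of y y e])
        (use e in auto)
    from has_derivative_unique[OF der[OF z(2)] this] show "dy i f z = 0"
      unfolding dy_eq_dirder z(1) by (rule fun_cong)
  next
    fix x y y'
    assume "\<forall>z\<in>D. \<forall>i. dy i f z = 0" and cc: "connected_component {y. (x, y) \<in> D} y y'"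
    then have "dirder (0, b) f (x, w) = 0" if "(x, w) \<in> D" for b w
      using dirder_eq_sum_partials[OF smooth_on_differentiable[OF f that], of 0 b] that by simp
    then have "((\<lambda>y. f (x, y)) has_derivative (\<lambda>b. 0)) (at w)" if "(x, w) \<in> D" for w
      using der[OF that] that by simp
    then show "f (x, y) = f (x, y')"
      using connected_component_subset[of "{y. (x, y) \<in> D}" y] cc connected_component_in[OF cc]
      by (intro has_derivative_zero_unique_connected[OF open_connected_component[OF fib, of x y]
            connected_connected_component]) 
         (auto simp: connected_component_in)
  qed
qed

locale conic_domain =
  fixes D :: "((real ^ 'n::finite) \<times> (real ^ 'n)) set"
  assumes open_D: "open D"
    and cone: "z \<in> D \<Longrightarrow> 0 < r \<Longrightarrow> (fst z, r *\<^sub>R snd z) \<in> D"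
begin

text \<open>Differentiate \<open>f (x, r y) = r\<^sup>d f (x, y)\<close> in the variables \<open>(x, y)\<close>; the direction \<open>(a, b)\<close>
  becomes \<open>(a, r b)\<close> on the left.\<close>
lemma homogeneous_dirder:
  fixes f :: "(real ^ 'n) \<times> (real ^ 'n) \<Rightarrow> real"
  assumes f: "smooth_on D f" "coord_pos_homogeneous D d f" and z: "z \<in> D" and r: "0 < r"
  shows "dirder (a, r *\<^sub>R b) f (fst z, r *\<^sub>R snd z) = r ^ d * dirder (a, b) f z"
proof -
  define L :: "(real ^ 'n) \<times> (real ^ 'n) \<Rightarrow> (real ^ 'n) \<times> (real ^ 'n)"
    where "L = (\<lambda>w. (fst w, r *\<^sub>R snd w))"
  have L: "bounded_linear L"
    unfolding L_def
    by (intro bounded_linear_Pair bounded_linear_fst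
        bounded_linear_compose[OF bounded_linear_scaleR_right bounded_linear_snd])
  have "L z \<in> D" using cone[OF z r] by (simp add: L_def)
  then have "dirder (a, b) (\<lambda>w. f (L w + 0)) z = dirder (L (a, b)) f (L z + 0)"
    using dirder_affine[OF L, of f z 0] smooth_on_differentiable[OF f(1)] by simp
  moreover have "dirder (a, b) (\<lambda>w. f (L w + 0)) z = dirder (a, b) (\<lambda>w. r ^ d * f w) z"
    using f(2) r by (intro dirder_cong[OF open_D z]) (simp add: L_def coord_pos_homogeneous_def)
  ultimately show ?thesis
    using dirder_cmult[OF smooth_on_differentiable[OF f(1) z], of "(a, b)" "r ^ d"]
    by (simp add: L_def)
qed

lemma homogeneous_dx:
  assumes "smooth_on D f" "coord_pos_homogeneous D d f"
  shows "coord_pos_homogeneous D d (dx k f)"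
  using homogeneous_dirder[OF assms, of _ _ "axis k 1" 0]
  by (simp add: coord_pos_homogeneous_def dx_eq_dirder)

lemma homogeneous_dy:
  assumes "smooth_on D f" "coord_pos_homogeneous D (Suc d) f"
  shows "coord_pos_homogeneous D d (dy k f)"
  unfolding coord_pos_homogeneous_def
proof (intro ballI allI impI)
  fix z and r :: real assume z: "z \<in> D" and r: "0 < r"
  have "dirder (r *\<^sub>R (0, axis k 1)) f (fst z, r *\<^sub>R snd z)
      = r * dirder (0, axis k 1) f (fst z, r *\<^sub>R snd z)"
    using linear_scale[OF dirder_linear[OF smooth_on_differentiable[OF assms(1) cone[OF z r]]], of r "(0, axis k 1)"]
    by simp
  with homogeneous_dirder[OF assms z r, of 0 "axis k 1"] r
  show "dy k f (fst z, r *\<^sub>R snd z) = r ^ d *\<^sub>R dy k f z" by (simp add: dy_eq_dirder)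
qed

text \<open>Euler's relation: differentiate \<open>f (x, r y) = r\<^sup>d f (x, y)\<close> in \<open>r\<close> at \<open>r = 1\<close>.\<close>
lemma euler:
  fixes f :: "(real ^ 'n) \<times> (real ^ 'n) \<Rightarrow> real"
  assumes f: "smooth_on D f" "coord_pos_homogeneous D d f" and z: "z \<in> D"
  shows "(\<Sum>k\<in>UNIV. snd z $ k * dy k f z) = d * f z"
proof -
  obtain x y where zxy: "z = (x, y)" by (cases z)
  have "((\<lambda>r. (x, r *\<^sub>R y)) has_derivative (\<lambda>t. (0, t *\<^sub>R y))) (at 1)"
    by (auto intro!: derivative_eq_intros)
  moreover have "(f has_derivative (\<lambda>v. dirder v f z)) (at (x, 1 *\<^sub>R y))"
    using has_derivative_dirder[OF smooth_on_differentiable[OF f(1) z]] by (simp add: zxy)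
  ultimately have 1: "((\<lambda>r. f (x, r *\<^sub>R y)) has_derivative (\<lambda>t. dirder (0, t *\<^sub>R y) f z)) (at 1)"
    by (rule has_derivative_compose)
  have "((\<lambda>r::real. r ^ d * f z) has_derivative (\<lambda>t::real. d * t * f z)) (at 1)"
    by (auto intro!: derivative_eq_intros)
  then have 2: "((\<lambda>r. f (x, r *\<^sub>R y)) has_derivative (\<lambda>t::real. d * t * f z)) (at 1)"
    by (rule has_derivative_transform_within_open[where s = "{0<..}"])
      (use f(2) z in \<open>auto simp: coord_pos_homogeneous_def zxy\<close>)
  have "(\<lambda>t. dirder (0, t *\<^sub>R y) f z) = (\<lambda>t::real. d * t * f z)"
    using has_derivative_unique[OF 1 2] .
  then have "dirder (0, 1 *\<^sub>R y) f z = real d * 1 * f z" by (rule fun_cong)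
  then show ?thesis
    using dirder_eq_sum_partials[OF smooth_on_differentiable[OF f(1) z], of 0 y] by (simp add: zxy)
qed

end

section \<open>Calculus of a spray on a conic domain\<close>

locale spray_domain = conic_domain D
  for D :: "((real ^ 'n::finite) \<times> (real ^ 'n)) set" +
  fixes G :: "(real ^ 'n) \<times> (real ^ 'n) \<Rightarrow> real ^ 'n"
  assumes smooth_G: "smooth_on D G" and homogeneous_G: "coord_pos_homogeneous D 2 G"
begin

lemma smooth_Gcomp: "smooth_on D (Gcomp G i)"
  by (rule smooth_on_linear_compose[OF open_D bounded_linear_vec_nth smooth_G])

lemma homogeneous_Gcomp: "coord_pos_homogeneous D 2 (Gcomp G i)"
  using homogeneous_G by (simp add: coord_pos_homogeneous_def)

lemma smooth_partials:
  assumes "smooth_on D f"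
  shows "smooth_on D (dx k f)" "smooth_on D (dy k f)"
  unfolding dx_eq_dirder dy_eq_dirder by (rule smooth_on_dirder[OF assms])+

lemma smooth_G1: "smooth_on D (G1 G i k)"
  unfolding G1_def by (rule smooth_partials[OF smooth_Gcomp])

lemma smooth_hdelta: 
  assumes "smooth_on D f" shows "smooth_on D (hdelta G k f)"
  unfolding hdelta_def[abs_def]
  by (intro smooth_on_diff smooth_on_sum smooth_on_mult open_D smooth_partials smooth_G1 assms)

lemma smooth_hdelta0: 
  assumes "smooth_on D f" shows "smooth_on D (hdelta0 G f)"
  unfolding hdelta0_def[abs_def]
  by (intro smooth_on_sum smooth_on_mult open_D smooth_hdelta smooth_on_snd_nth assms)

lemmas differentiable_D = smooth_on_differentiable[of D]

lemma hdelta0_eq: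
  assumes z: "z \<in> D"
  shows "hdelta0 G f z = (\<Sum>j\<in>UNIV. snd z $ j * dx j f z) - 2 * (\<Sum>j\<in>UNIV. Gcomp G j z * dy j f z)"
proof -
  have "(\<Sum>i\<in>UNIV. (\<Sum>r\<in>UNIV. G1 G r i z * dy r f z) * snd z $ i)
      = (\<Sum>r\<in>UNIV. (\<Sum>i\<in>UNIV. snd z $ i * G1 G r i z) * dy r f z)"
    by (simp add: sum_distrib_right, subst sum.swap, simp add: mult_ac)
  also have "\<dots> = (\<Sum>r\<in>UNIV. (2 * Gcomp G r z) * dy r f z)"
    using euler[OF smooth_Gcomp homogeneous_Gcomp z] by (simp add: G1_def)
  finally have e: "(\<Sum>i\<in>UNIV. (\<Sum>r\<in>UNIV. G1 G r i z * dy r f z) * snd z $ i)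
      = 2 * (\<Sum>j\<in>UNIV. Gcomp G j z * dy j f z)"
    by (simp add: sum_distrib_left mult_ac)
  have "hdelta0 G f z = (\<Sum>i\<in>UNIV. dx i f z * snd z $ i)
      - (\<Sum>i\<in>UNIV. (\<Sum>r\<in>UNIV. G1 G r i z * dy r f z) * snd z $ i)"
    by (simp add: hdelta0_def hdelta_def left_diff_distrib sum_subtractf)
  then show ?thesis unfolding e by (simp add: mult.commute)
qed

text \<open>The operator \<open>f \<mapsto> f\<^bsub>;0\<^esub>\<close> is differentiation along the spray \<open>y\<^sup>i \<partial>\<^sub>i - 2 G\<^sup>i \<partial>/\<partial>y\<^sup>i\<close>. At a fixed
  point it is therefore a directional derivative and obeys the product rule.\<close>
lemma hdelta0_eq_dirder:
  assumes "smooth_on D f" "z \<in> D"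
  shows "hdelta0 G f z = dirder (snd z, - 2 *\<^sub>R G z) f z"
  unfolding hdelta0_eq[OF assms(2)] dirder_eq_sum_partials[OF differentiable_D[OF assms]]
  by (simp add: sum_distrib_left sum_negf mult_ac)

text \<open>The commutator of a constant vector field with the spray. The two additional sums come from
  differentiating the coefficients \<open>y\<^sup>j\<close> and \<open>-2 G\<^sup>j\<close> of the spray in the direction \<open>v\<close>.\<close>
lemma dirder_hdelta0:
  assumes f: "smooth_on D f" and z: "z \<in> D"
  shows "dirder v (hdelta0 G f) z = hdelta0 G (dirder v f) z
    + (\<Sum>j\<in>UNIV. snd v $ j * dx j f z) - 2 * (\<Sum>j\<in>UNIV. dirder v (Gcomp G j) z * dy j f z)"
proof -
  note sm = smooth_partials[OF f] smooth_on_snd_nth[OF open_D] smooth_Gcomp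
  have comm: "dirder v (dx j f) z = dx j (dirder v f) z" "dirder v (dy j f) z = dy j (dirder v f) z" for j
    unfolding dx_eq_dirder dy_eq_dirder by (rule dirder_commute[OF open_D f z])+
  have "dirder v (hdelta0 G f) z = dirder v (\<lambda>z. (\<Sum>j\<in>UNIV. snd z $ j * dx j f z) 
      - 2 * (\<Sum>j\<in>UNIV. Gcomp G j z * dy j f z)) z"
    by (rule dirder_cong[OF open_D z hdelta0_eq])
  also have "\<dots> = dirder v (\<lambda>z. \<Sum>j\<in>UNIV. snd z $ j * dx j f z) z
      - 2 * dirder v (\<lambda>z. \<Sum>j\<in>UNIV. Gcomp G j z * dy j f z) z"
    by (subst dirder_diff dirder_cmult,
      (intro differentiable_D z smooth_on_mult smooth_on_sum smooth_on_const sm open_D)+)+ simp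
  also have "\<dots> = (\<Sum>j\<in>UNIV. snd v $ j * dx j f z) + (\<Sum>j\<in>UNIV. snd z $ j * dirder v (dx j f) z)
      - 2 * ((\<Sum>j\<in>UNIV. dirder v (Gcomp G j) z * dy j f z) + (\<Sum>j\<in>UNIV. Gcomp G j z * dirder v (dy j f) z))"
    by (simp add: dirder_sum_mult differentiable_D[OF _ z] sm dirder_snd_nth)
  finally show ?thesis unfolding hdelta0_eq[OF z] comm by (simp add: algebra_simps)
qed

text \<open>Contracting the connection term of \<open>f\<^bsub>.k;j\<^esub>\<close> with \<open>y\<^sup>j\<close> gives \<open>f\<^bsub>.r\<^esub> G\<^sup>r\<^sub>k\<close>, because \<open>G\<^sup>r\<^sub>k\<close> is
  homogeneous of degree one. The rest is the commutator with the direction \<open>\<partial>/\<partial>y\<^sup>k\<close>.\<close>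
lemma vh_deriv0_eq:
  assumes f: "smooth_on D f" and z: "z \<in> D"
  shows "vh_deriv0 G k f z = dy k (hdelta0 G f) z - hdelta G k f z"
proof -
  have "vh_deriv0 G k f z = hdelta0 G (dy k f) z
     - (\<Sum>j\<in>UNIV. \<Sum>r\<in>UNIV. dy r f z * G2 G r k j z * snd z $ j)"
    by (simp add: vh_deriv0_def vh_deriv_def hdelta0_def left_diff_distrib sum_subtractf sum_distrib_right)
  also have "(\<Sum>j\<in>UNIV. \<Sum>r\<in>UNIV. dy r f z * G2 G r k j z * snd z $ j)
     = (\<Sum>r\<in>UNIV. (\<Sum>j\<in>UNIV. snd z $ j * dy j (G1 G r k) z) * dy r f z)"
    by (subst sum.swap) (simp add: sum_distrib_left sum_distrib_right mult_ac G2_def G1_def)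
  also have "\<dots> = (\<Sum>r\<in>UNIV. G1 G r k z * dy r f z)"
    using euler[OF smooth_G1 _ z, of 1] homogeneous_dy[OF smooth_Gcomp, of 1] homogeneous_Gcomp
    by (simp add: G1_def numeral_2_eq_2)
  finally have "vh_deriv0 G k f z = hdelta0 G (dy k f) z - (\<Sum>r\<in>UNIV. G1 G r k z * dy r f z)" .
  moreover have "(\<Sum>j\<in>UNIV. axis k 1 $ j * dx j f z) = dx k f z"
    by (simp add: axis_def if_distrib[of "\<lambda>t. t * _"] cong: if_cong)
  ultimately show ?thesis
    using dirder_hdelta0[OF f z, of "(0, axis k 1)"]
    by (simp add: hdelta_def G1_def dy_eq_dirder[symmetric])
qed

lemma hamel_iff:
  assumes f: "smooth_on D f" and z: "z \<in> D"
  shows "hdelta G k f z = vh_deriv0 G k f z \<longleftrightarrow> dy k (hdelta0 G f) z = 2 * hdelta G k f z"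
  using vh_deriv0_eq[OF assms] by auto

text \<open>The Funk equation contracted with \<open>y\<^sup>k\<close> gives \<open>q\<^bsub>;0\<^esub> = q\<^sup>2\<close>, whose derivative in \<open>y\<^sup>k\<close> is
  \<open>2 q q\<^bsub>.k\<^esub> = 2 q\<^bsub>;k\<^esub>\<close>. By \<open>hamel_iff\<close> this is the Hamel equation.\<close>
lemma funk_imp_hamel:
  assumes q: "smooth_on D q" "coord_pos_homogeneous D 1 q"
    and funk: "\<And>z k. z \<in> D \<Longrightarrow> hdelta G k q z = q z * dy k q z" and z: "z \<in> D"
  shows "hdelta G k q z = vh_deriv0 G k q z"
proof -
  have "hdelta0 G q w = q w * q w" if w: "w \<in> D" for w
  proof -
    have "hdelta0 G q w = q w * (\<Sum>k\<in>UNIV. snd w $ k * dy k q w)"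
      by (simp add: hdelta0_def funk[OF w] sum_distrib_left mult_ac)
    then show ?thesis using euler[OF q w] by simp
  qed
  then have "dy k (hdelta0 G q) z = dy k (\<lambda>w. q w * q w) z"
    unfolding dy_eq_dirder by (intro dirder_cong[OF open_D z]) 
  also have "\<dots> = 2 * hdelta G k q z"
    using dirder_mult[OF differentiable_D[OF q(1) z] differentiable_D[OF q(1) z]]
    by (simp add: dy_eq_dirder funk[OF z])
  finally show ?thesis using hamel_iff[OF q(1) z] by blast
qed

text \<open>With \<open>p = q\<^bsub>;0\<^esub>/(2q)\<close> and \<open>H = G + p y\<close>, Euler's relation turns the change of the connection
  coefficients into \<open>q\<^bsub>;k\<^esub> \<mapsto> q\<^bsub>;k\<^esub> - (p q)\<^bsub>.k\<^esub>\<close>, and \<open>p q = q\<^bsub>;0\<^esub>/2\<close>.\<close>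
lemma hdelta_associated_eq_0:
  assumes q: "smooth_on D q" "coord_pos_homogeneous D 1 q" "\<And>z. z \<in> D \<Longrightarrow> q z \<noteq> 0"
    and hamel: "\<And>z k. z \<in> D \<Longrightarrow> hdelta G k q z = vh_deriv0 G k q z"
    and H: "\<And>z. z \<in> D \<Longrightarrow> H z = G z + (hdelta0 G q z / (2 * q z)) *\<^sub>R snd z"
    and z: "z \<in> D"
  shows "hdelta H k q z = 0"
proof -
  define p where "p = (\<lambda>z. hdelta0 G q z / (2 * q z))"
  have p: "smooth_on D p" unfolding p_def
    using q(3) by (intro smooth_on_divide smooth_on_mult smooth_on_const smooth_hdelta0 q open_D) auto
  have H1: "G1 H r k z = G1 G r k z + (dy k p z * snd z $ r + p z * axis k 1 $ r)" for r
  proof -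
    have "G1 H r k z = dy k (\<lambda>w. G w $ r + p w * snd w $ r) z"
      unfolding G1_def dy_eq_dirder by (rule dirder_cong[OF open_D z]) (simp add: H p_def)
    also have "\<dots> = dy k (Gcomp G r) z + dy k (\<lambda>w. p w * snd w $ r) z"
      unfolding dy_eq_dirder
      by (intro dirder_add differentiable_D z smooth_on_mult p smooth_on_snd_nth open_D smooth_Gcomp)
    also have "dy k (\<lambda>w. p w * snd w $ r) z = dy k p z * snd z $ r + p z * axis k 1 $ r"
      unfolding dy_eq_dirder
      by (subst dirder_mult) (simp_all add: differentiable_D z p smooth_on_snd_nth open_D dirder_snd_nth)
    finally show ?thesis unfolding G1_def .
  qed
  have ax: "(\<Sum>r\<in>UNIV. axis k 1 $ r * dy r q z) = dy k q z"
    by (simp add: axis_def if_distrib[of "\<lambda>t. t * _"] cong: if_cong)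
  have "(\<Sum>r\<in>UNIV. G1 H r k z * dy r q z) = (\<Sum>r\<in>UNIV. G1 G r k z * dy r q z)
      + dy k p z * (\<Sum>r\<in>UNIV. snd z $ r * dy r q z) + p z * (\<Sum>r\<in>UNIV. axis k 1 $ r * dy r q z)"
    by (simp add: H1 distrib_right sum.distrib sum_distrib_left mult.assoc)
  also have "\<dots> = (\<Sum>r\<in>UNIV. G1 G r k z * dy r q z) + (dy k p z * q z + p z * dy k q z)"
    using euler[OF q(1,2) z] ax by simp
  also have "dy k p z * q z + p z * dy k q z = dy k (\<lambda>w. p w * q w) z"
    unfolding dy_eq_dirder using dirder_mult[OF differentiable_D[OF p z] differentiable_D[OF q(1) z]] by simp
  also have "\<dots> = dy k (\<lambda>w. (1/2) * hdelta0 G q w) z"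
    unfolding dy_eq_dirder by (rule dirder_cong[OF open_D z]) (simp add: p_def q(3))
  also have "\<dots> = (1/2) * dy k (hdelta0 G q) z"
    unfolding dy_eq_dirder by (rule dirder_cmult[OF differentiable_D[OF smooth_hdelta0[OF q(1)] z]])
  also have "\<dots> = hdelta G k q z" using hamel[OF z] hamel_iff[OF q(1) z] by simp
  finally show ?thesis by (simp add: hdelta_def)
qed

text \<open>Write \<open>S f\<close> for \<open>f\<^bsub>;0\<^esub>\<close>, so that \<open>R\<^sup>i\<^sub>k = 2 \<partial>\<^sub>k G\<^sup>i - S G\<^sup>i\<^sub>k - G\<^sup>i\<^sub>j G\<^sup>j\<^sub>k\<close>. Horizontal constancy says
  \<open>\<partial>\<^sub>k q = G\<^sup>i\<^sub>k q\<^bsub>.i\<^esub>\<close>, and \<open>S q = 0\<close> follows. Applying \<open>S\<close> to the first equation and using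
  the commutators of \<open>S\<close> with the coordinate fields to evaluate \<open>S \<partial>\<^sub>k q = 2 q\<^bsub>.j\<^esub> \<partial>\<^sub>k G\<^sup>j\<close> and
  \<open>S q\<^bsub>.i\<^esub> = G\<^sup>j\<^sub>i q\<^bsub>.j\<^esub>\<close> gives exactly the contracted curvature.\<close>
lemma riemann_annihilates:
  assumes q: "smooth_on D q"
    and par: "\<And>z k. z \<in> D \<Longrightarrow> hdelta G k q z = 0"
    and z: "z \<in> D"
  shows "(\<Sum>i\<in>UNIV. riemann G i k z * dy i q z) = 0"
proof -
  have S0: "hdelta0 G q w = 0" if "w \<in> D" for w by (simp add: hdelta0_def par[OF that])
  have dS0: "dirder v (hdelta0 G q) z = 0" for v
    using dirder_cong[OF open_D z S0, where v = v] by (simp add: dirder_const)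
  have dxq: "dx k q w = (\<Sum>i\<in>UNIV. G1 G i k w * dy i q w)" if "w \<in> D" for w k
    using par[OF that, of k] by (simp add: hdelta_def)
  have Sx: "hdelta0 G (dx k q) z = 2 * (\<Sum>j\<in>UNIV. dx k (Gcomp G j) z * dy j q z)"
    using dirder_hdelta0[OF q z, of "(axis k 1, 0)"] by (simp add: dS0 dx_eq_dirder)
  have "(\<Sum>j\<in>UNIV. axis i 1 $ j * dx j q z) = dx i q z" for i
    by (simp add: axis_def if_distrib[of "\<lambda>t. t * _"] cong: if_cong)
  then have Sy: "hdelta0 G (dy i q) z = (\<Sum>j\<in>UNIV. G1 G j i z * dy j q z)" for i
    using dirder_hdelta0[OF q z, of "(0, axis i 1)", unfolded dS0] dxq[OF z, of i]
    by (simp add: dy_eq_dirder[symmetric] G1_def)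
  have "hdelta0 G (dx k q) z = dirder (snd z, - 2 *\<^sub>R G z) (dx k q) z"
    by (rule hdelta0_eq_dirder[OF smooth_partials(1)[OF q] z])
  also have "\<dots> = dirder (snd z, - 2 *\<^sub>R G z) (\<lambda>w. \<Sum>i\<in>UNIV. G1 G i k w * dy i q w) z"
    by (rule dirder_cong[OF open_D z dxq])
  also have "\<dots> = (\<Sum>i\<in>UNIV. hdelta0 G (G1 G i k) z * dy i q z) + (\<Sum>i\<in>UNIV. G1 G i k z * hdelta0 G (dy i q) z)"
    by (subst dirder_sum_mult)
      (simp_all add: differentiable_D[OF _ z] smooth_G1 smooth_partials[OF q] hdelta0_eq_dirder[OF _ z])
  finally have key: "2 * (\<Sum>i\<in>UNIV. dx k (Gcomp G i) z * dy i q z)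
     = (\<Sum>i\<in>UNIV. hdelta0 G (G1 G i k) z * dy i q z)
     + (\<Sum>i\<in>UNIV. G1 G i k z * (\<Sum>j\<in>UNIV. G1 G j i z * dy j q z))"
    unfolding Sx Sy .
  have R: "riemann G i k z = 2 * dx k (Gcomp G i) z - hdelta0 G (G1 G i k) z
      - (\<Sum>j\<in>UNIV. G1 G i j z * G1 G j k z)" for i
    by (simp add: riemann_def hdelta0_eq[OF z] G1_def)
  have "(\<Sum>i\<in>UNIV. (\<Sum>j\<in>UNIV. G1 G i j z * G1 G j k z) * dy i q z)
      = (\<Sum>i\<in>UNIV. G1 G i k z * (\<Sum>j\<in>UNIV. G1 G j i z * dy j q z))"
    by (simp add: sum_distrib_right sum_distrib_left, subst sum.swap, simp add: mult_ac)
  moreover have "(\<Sum>i\<in>UNIV. riemann G i k z * dy i q z)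
      = 2 * (\<Sum>i\<in>UNIV. dx k (Gcomp G i) z * dy i q z)
      - (\<Sum>i\<in>UNIV. hdelta0 G (G1 G i k) z * dy i q z)
      - (\<Sum>i\<in>UNIV. (\<Sum>j\<in>UNIV. G1 G i j z * G1 G j k z) * dy i q z)"
    by (simp add: R left_diff_distrib sum_subtractf sum_distrib_left mult.assoc)
  ultimately show ?thesis using key by simp
qed

lemma homogeneous_riemann: "coord_pos_homogeneous D 2 (riemann G i k)"
proof -
  note h = homogeneous_Gcomp
  have h1: "coord_pos_homogeneous D 1 (dy k (Gcomp G i))" for k i
    using homogeneous_dy[OF smooth_Gcomp, of 1] h by (simp add: numeral_2_eq_2)
  have h2: "coord_pos_homogeneous D 0 (dy j (dy k (Gcomp G i)))" for j k i
    using homogeneous_dy[OF smooth_partials(2)[OF smooth_Gcomp], of 0] h1 by simp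
  note hx = homogeneous_dx[OF smooth_Gcomp h] homogeneous_dx[OF smooth_partials(2)[OF smooth_Gcomp] h1]
  show ?thesis
    using h h1 h2 hx
    unfolding coord_pos_homogeneous_def riemann_def
    by (simp add: sum_distrib_left power2_eq_square algebra_simps)
qed

end

section \<open>Tangent vectors in coordinates\<close>

locale conical_manifold =
  fixes X :: "'m topology" and A :: "('m, 'n::finite) chart set" and C :: "('m, 'n) tangent set"
  assumes manifold: "smooth_manifold X A" and conical: "conical_region A C"
begin

lemma chart_inv_in:
  assumes "x \<in> chart_image c"
  shows "chart_inv c x \<in> fst c" "snd c (chart_inv c x) = x"
  using assms unfolding chart_image_def chart_inv_def by (auto intro: inv_into_into f_inv_into_f)

lemma chart_inv_chart:
  assumes "c \<in> A" "p \<in> fst c"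
  shows "chart_inv c (snd c p) = p"
proof -
  have c: "is_chart X c" using manifold assms unfolding smooth_manifold_def by blast
  then have "fst c \<subseteq> topspace X" unfolding is_chart_def using openin_subset by blast
  then have "inj_on (snd c) (fst c)"
    using c homeomorphic_imp_injective_map[of "subtopology X (fst c)" "top_of_set (chart_image c)" "snd c"]
    unfolding is_chart_def by (simp add: Int_absorb1)
  then show ?thesis unfolding chart_inv_def using assms by simp
qed

lemma transition_differentiable:
  assumes "c \<in> A" "c' \<in> A" "x \<in> chart_image c" "chart_inv c x \<in> fst c'"
  shows "transition c c' differentiable (at x)"
proof -
  have "smooth_on (snd c ` (fst c \<inter> fst c')) (transition c c')"
    using manifold assms unfolding smooth_manifold_def by blast
  moreover have "x \<in> snd c ` (fst c \<inter> fst c')"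
    using chart_inv_in[OF assms(3)] assms(4) by (intro image_eqI[of _ _ "chart_inv c x"]) simp_all
  ultimately show ?thesis by (rule smooth_on_differentiable)
qed

text \<open>A tangent vector is determined by its components in a single chart, the others being their images
  under the Jacobians.\<close>
lemma tangent_eq_tvec:
  assumes "\<xi> \<in> tangent_bundle A" "c \<in> A" "fst \<xi> \<in> fst c"
  shows "\<xi> = tvec A c (snd c (fst \<xi>), snd \<xi> c)"
proof -
  obtain p v where \<xi>: "\<xi> = (p, v)" by (cases \<xi>)
  have zero: "\<forall>c. c \<notin> A \<or> p \<notin> fst c \<longrightarrow> v c = 0"
    and jac: "\<forall>c\<in>A. \<forall>c'\<in>A. p \<in> fst c \<and> p \<in> fst c' \<longrightarrow>
        v c' = frechet_derivative (transition c c') (at (snd c p)) (v c)"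
    using assms(1) unfolding tangent_bundle_def \<xi> mem_Collect_eq case_prod_conv
    by - (elim conjE, assumption)+
  have p: "p \<in> fst c" using assms(3) by (simp add: \<xi>)
  have "v c' = (if c' \<in> A \<and> p \<in> fst c'
      then frechet_derivative (transition c c') (at (snd c p)) (v c) else 0)" for c'
  proof (cases "c' \<in> A \<and> p \<in> fst c'")
    case True
    then show ?thesis using jac[rule_format, OF assms(2), of c'] p unfolding if_P[OF True] by blast
  next
    case False
    then show ?thesis using zero[rule_format, of c'] unfolding if_not_P[OF False] by blast
  qed
  then have "v = (\<lambda>c'. if c' \<in> A \<and> p \<in> fst c'
      then frechet_derivative (transition c c') (at (snd c p)) (v c) else 0)" by (rule ext)
  then show ?thesis
    unfolding \<xi> tvec_def fst_conv snd_conv chart_inv_chart[OF assms(2) p] by (rule arg_cong)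
qed

lemma tscale_tvec:
  assumes "c \<in> A" "fst z \<in> chart_image c"
  shows "tscale r (tvec A c z) = tvec A c (fst z, r *\<^sub>R snd z)"
proof -
  have "r *\<^sub>R frechet_derivative (transition c c') (at (fst z)) (snd z)
      = frechet_derivative (transition c c') (at (fst z)) (r *\<^sub>R snd z)"
    if "c' \<in> A" "chart_inv c (fst z) \<in> fst c'" for c'
    by (rule linear_scale[symmetric, OF linear_frechet_derivative[OF
          transition_differentiable[OF assms(1) that(1) assms(2) that(2)]]])
  then show ?thesis by (auto simp: tscale_def tvec_def)
qed

lemma in_tangent_bundle: "\<xi> \<in> C \<Longrightarrow> \<xi> \<in> tangent_bundle A"
  using conical unfolding conical_region_def by blast

lemma tangent_in_chart:
  assumes "\<xi> \<in> C" "c \<in> A" "fst \<xi> \<in> fst c"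
  shows "(snd c (fst \<xi>), snd \<xi> c) \<in> coord_dom A C c"
    and "\<xi> = tvec A c (snd c (fst \<xi>), snd \<xi> c)"
proof -
  show e: "\<xi> = tvec A c (snd c (fst \<xi>), snd \<xi> c)"
    by (rule tangent_eq_tvec[OF in_tangent_bundle[OF assms(1)] assms(2,3)])
  show "(snd c (fst \<xi>), snd \<xi> c) \<in> coord_dom A C c"
    using assms by (simp add: coord_dom_def chart_image_def e[symmetric])
qed

lemma base_point_in_chart:
  assumes "\<xi> \<in> C"
  obtains c where "c \<in> A" "fst \<xi> \<in> fst c"
proof -
  have "fst \<xi> \<in> (\<Union>c\<in>A. fst c)" 
    using in_tangent_bundle[OF assms] unfolding tangent_bundle_def mem_Collect_eq case_prod_unfold
    by (elim conjE)
  with that show ?thesis by blast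
qed

lemma tangent_in_some_chart:
  assumes "\<xi> \<in> C"
  obtains c z where "c \<in> A" "z \<in> coord_dom A C c" "\<xi> = tvec A c z"
proof -
  obtain c where c: "c \<in> A" "fst \<xi> \<in> fst c" using base_point_in_chart[OF assms] .
  show ?thesis by (rule that[OF c(1) tangent_in_chart[OF assms c]])
qed

lemma tvec_in: "z \<in> coord_dom A C c \<Longrightarrow> tvec A c z \<in> C"
  and fst_in_chart_image: "z \<in> coord_dom A C c \<Longrightarrow> fst z \<in> chart_image c"
  by (simp_all add: coord_dom_def)

lemma conic_domain_coord_dom:
  assumes "c \<in> A" shows "conic_domain (coord_dom A C c)"
proof
  show "open (coord_dom A C c)" using conical assms by (simp add: conical_region_def)
  fix z and r :: real assume z: "z \<in> coord_dom A C c" "0 < r"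
  then have "tscale r (tvec A c z) \<in> C"
    using conical tvec_in by (simp add: conical_region_def)
  then show "(fst z, r *\<^sub>R snd z) \<in> coord_dom A C c"
    using tscale_tvec[OF assms fst_in_chart_image[OF z(1)]] fst_in_chart_image[OF z(1)]
    by (simp add: coord_dom_def)
qed

lemma open_coord_dom: "c \<in> A \<Longrightarrow> open (coord_dom A C c)"
  using conic_domain_coord_dom conic_domain.open_D by blast

lemma pos_homogeneous_iff:
  "pos_homogeneous C d f \<longleftrightarrow> (\<forall>c\<in>A. coord_pos_homogeneous (coord_dom A C c) d (coord_expr A c f))"
proof (intro iffI ballI)
  fix c assume "pos_homogeneous C d f" "c \<in> A"
  then show "coord_pos_homogeneous (coord_dom A C c) d (coord_expr A c f)"
    using tscale_tvec[OF _ fst_in_chart_image, symmetric] tvec_in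
    by (simp add: coord_pos_homogeneous_def coord_expr_def pos_homogeneous_def)
next
  assume h: "\<forall>c\<in>A. coord_pos_homogeneous (coord_dom A C c) d (coord_expr A c f)"
  show "pos_homogeneous C d f"
    unfolding pos_homogeneous_def
  proof (intro ballI allI impI)
    fix \<xi> and r :: real assume "\<xi> \<in> C" "r > 0"
    moreover obtain c z where "c \<in> A" "z \<in> coord_dom A C c" "\<xi> = tvec A c z"
      using tangent_in_some_chart[OF \<open>\<xi> \<in> C\<close>] .
    ultimately show "f (tscale r \<xi>) = r ^ d * f \<xi>"
      using h tscale_tvec[OF _ fst_in_chart_image]
      by (simp add: coord_pos_homogeneous_def coord_expr_def)
  qed
qed

lemma spray_domain_coord_dom:
  assumes "spray A C G" "c \<in> A" shows "spray_domain (coord_dom A C c) (G c)"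
  using assms conic_domain_coord_dom
  by (simp add: spray_domain_def spray_domain_axioms_def spray_def)

lemma funk_function_imp_hamel_function:
  assumes "spray A C G" "funk_function A C G Q"
  shows "hamel_function A C G Q"
proof -
  have Q: "smooth_fun A C Q" "pos_homogeneous C 1 Q"
    and funk: "\<And>c z k. c \<in> A \<Longrightarrow> z \<in> coord_dom A C c \<Longrightarrow>
      hdelta (G c) k (coord_expr A c Q) z = coord_expr A c Q z * dy k (coord_expr A c Q) z"
    using assms(2) by (simp_all add: funk_function_def)
  have "hdelta (G c) k (coord_expr A c Q) z = vh_deriv0 (G c) k (coord_expr A c Q) z"
    if c: "c \<in> A" and z: "z \<in> coord_dom A C c" for c z k
  proof -
    have "smooth_on (coord_dom A C c) (coord_expr A c Q)"
      "coord_pos_homogeneous (coord_dom A C c) 1 (coord_expr A c Q)"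
      using Q c pos_homogeneous_iff by (simp_all add: smooth_fun_def)
    from spray_domain.funk_imp_hamel[OF spray_domain_coord_dom[OF assms(1) c] this funk[OF c] z]
    show ?thesis .
  qed
  with Q show ?thesis by (simp add: hamel_function_def)
qed

lemma funk_spray_imp_hamel_spray: "funk_spray A C H Q \<Longrightarrow> hamel_spray A C H Q"
  unfolding funk_spray_def hamel_spray_def using funk_function_imp_hamel_function by blast

section \<open>Functions of the base point\<close>

lemma locally_base_fun_iff:
  assumes f: "smooth_fun A C f"
  shows "locally_base_fun A C f \<longleftrightarrow>
    (\<forall>c\<in>A. \<forall>z\<in>coord_dom A C c. \<forall>i. dy i (coord_expr A c f) z = 0)"
proof -
  have "(\<forall>x\<in>chart_image c. \<forall>y y'. connected_component (coord_fibre A C c x) y y' \<longrightarrow>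
           coord_expr A c f (x, y) = coord_expr A c f (x, y'))
      \<longleftrightarrow> (\<forall>x y y'. connected_component {y. (x, y) \<in> coord_dom A C c} y y' \<longrightarrow>
           coord_expr A c f (x, y) = coord_expr A c f (x, y'))" for c
  proof -
    have "x \<in> chart_image c" if "connected_component {y. (x, y) \<in> coord_dom A C c} y y'" for x y y'
      using connected_component_in[OF that] fst_in_chart_image[of "(x, y)" c] by simp
    then show ?thesis unfolding coord_fibre_def by blast
  qed
  then show ?thesis
    using locally_constant_on_fibres_iff[OF open_coord_dom] f
    unfolding locally_base_fun_def smooth_fun_def by simp
qed

text \<open>The segment from \<open>y\<close> to \<open>r y\<close> stays on the open ray through \<open>y\<close>, hence in one component of the
  conic fibre.\<close>
lemma locally_base_fun_homogeneous:
  assumes "locally_base_fun A C f"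
  shows "pos_homogeneous C 0 f"
  unfolding pos_homogeneous_iff coord_pos_homogeneous_def
proof (intro ballI allI impI)
  fix c z and r :: real assume c: "c \<in> A" and z: "z \<in> coord_dom A C c" and r: "0 < r"
  have "closed_segment (snd z) (r *\<^sub>R snd z) \<subseteq> coord_fibre A C c (fst z)"
  proof
    fix y assume "y \<in> closed_segment (snd z) (r *\<^sub>R snd z)"
    then obtain t where t: "0 \<le> t" "t \<le> 1" "y = (1 - t) *\<^sub>R snd z + t *\<^sub>R r *\<^sub>R snd z"
      unfolding in_segment by blast
    then have "y = ((1 - t) + t * r) *\<^sub>R snd z" by (simp add: scaleR_left_distrib)
    moreover have "0 < (1 - t) + t * r"
      using t r by (cases "t = 0") (auto intro: add_nonneg_pos)
    ultimately show "y \<in> coord_fibre A C c (fst z)"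
      using conic_domain.cone[OF conic_domain_coord_dom[OF c] z] by (simp add: coord_fibre_def)
  qed
  then have "connected_component (coord_fibre A C c (fst z)) (snd z) (r *\<^sub>R snd z)"
    unfolding connected_component_def by (metis connected_segment(1) ends_in_segment)
  then show "coord_expr A c f (fst z, r *\<^sub>R snd z) = r ^ 0 *\<^sub>R coord_expr A c f z"
    using assms c fst_in_chart_image[OF z] unfolding locally_base_fun_def by fastforce
qed

lemma base_fun_lift:
  assumes "smooth_base_fun A C \<mu>"
  shows "smooth_fun A C (\<lambda>\<xi>. \<mu> (fst \<xi>))" "locally_base_fun A C (\<lambda>\<xi>. \<mu> (fst \<xi>))"
proof -
  have e: "coord_expr A c (\<lambda>\<xi>. \<mu> (fst \<xi>)) z = \<mu> (chart_inv c (fst z))" for c z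
    by (simp add: coord_expr_def tvec_def)
  show "locally_base_fun A C (\<lambda>\<xi>. \<mu> (fst \<xi>))" by (simp add: locally_base_fun_def e)
  show "smooth_fun A C (\<lambda>\<xi>. \<mu> (fst \<xi>))"
    unfolding smooth_fun_def e[abs_def]
  proof
    fix c assume c: "c \<in> A"
    have "smooth_on (coord_dom A C c) (\<lambda>z. (\<lambda>x. \<mu> (chart_inv c x)) (fst z + 0))"
      using assms c
      by (intro smooth_on_affine_compose[where S = "fst ` coord_dom A C c"] bounded_linear_fst open_coord_dom)
        (auto simp: smooth_base_fun_def)
    then show "smooth_on (coord_dom A C c) (\<lambda>z. \<mu> (chart_inv c (fst z)))" by simp
  qed
qed

text \<open>Near a point of the base, \<open>\<mu>\<close> is the coordinate expression of \<open>f\<close> along a local section \<open>x \<mapsto> (x, y)\<close>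
  with constant components \<open>y\<close>. This gives the smoothness of \<open>\<mu>\<close>.\<close>
lemma locally_base_fun_descends:
  assumes conn: "connected_fibres A C" and f: "smooth_fun A C f" "locally_base_fun A C f"
  obtains \<mu> where "smooth_base_fun A C \<mu>" "\<And>\<xi>. \<xi> \<in> C \<Longrightarrow> f \<xi> = \<mu> (fst \<xi>)"
proof -
  have const: "f \<xi> = f \<xi>'" if "\<xi> \<in> C" "\<xi>' \<in> C" "fst \<xi>' = fst \<xi>" for \<xi> \<xi>'
  proof -
    have "\<exists>c\<in>A. fst \<xi> \<in> fst c" using base_point_in_chart[OF that(1)] by blast
    then obtain c where c: "c \<in> A" "fst \<xi> \<in> fst c" by blast
    note 1 = tangent_in_chart[OF that(1) c] and 2 = tangent_in_chart[OF that(2) c(1), unfolded that(3), OF c(2)]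
    have "connected (coord_fibre A C c (snd c (fst \<xi>)))"
      using conn c fst_in_chart_image[OF 1(1)] by (simp add: connected_fibres_def)
    then have "connected_component (coord_fibre A C c (snd c (fst \<xi>))) (snd \<xi> c) (snd \<xi>' c)"
      using 1(1) 2(1) unfolding connected_component_def coord_fibre_def by blast
    then have "coord_expr A c f (snd c (fst \<xi>), snd \<xi> c) = coord_expr A c f (snd c (fst \<xi>), snd \<xi>' c)"
      using f(2) c fst_in_chart_image[OF 1(1)] unfolding locally_base_fun_def by simp
    then show ?thesis using 1(2) 2(2) by (simp add: coord_expr_def)
  qed
  define \<mu> where "\<mu> p = f (SOME \<xi>. \<xi> \<in> C \<and> fst \<xi> = p)" for p
  have \<mu>: "f \<xi> = \<mu> (fst \<xi>)" if "\<xi> \<in> C" for \<xi>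
  proof -
    have "(SOME \<xi>'. \<xi>' \<in> C \<and> fst \<xi>' = fst \<xi>) \<in> C
        \<and> fst (SOME \<xi>'. \<xi>' \<in> C \<and> fst \<xi>' = fst \<xi>) = fst \<xi>"
      by (rule someI[of _ \<xi>]) (use that in blast)
    then show ?thesis unfolding \<mu>_def by (intro const that) auto
  qed
  have "smooth_base_fun A C \<mu>"
    unfolding smooth_base_fun_def
  proof (intro ballI smooth_on_local)
    fix c x assume c: "c \<in> A" and "x \<in> fst ` coord_dom A C c"
    then obtain y where xy: "(x, y) \<in> coord_dom A C c" by auto
    let ?U = "{x'. (x', y) \<in> coord_dom A C c}"
    have U: "open ?U"
      using open_vimage[OF open_coord_dom[OF c], of "\<lambda>x. (x, y)"] by (simp add: vimage_def continuous_on_Pair)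
    have L: "bounded_linear (\<lambda>x::real ^ 'n. (x, 0 :: real ^ 'n))"
      by (intro bounded_linear_Pair bounded_linear_ident bounded_linear_zero)
    have "smooth_on ?U (\<lambda>x'. coord_expr A c f ((x', 0) + (0, y)))"
      using f(1) c by (intro smooth_on_affine_compose[OF U L]) (auto simp: smooth_fun_def)
    moreover have "coord_expr A c f ((x', 0) + (0, y)) = \<mu> (chart_inv c x')" if "x' \<in> ?U" for x'
      using \<mu>[OF tvec_in[of "(x', y)" c]] that by (simp add: coord_expr_def tvec_def)
    ultimately have "smooth_on ?U (\<lambda>x'. \<mu> (chart_inv c x'))"
      using smooth_on_cong[OF U] by (metis (no_types, lifting))
    then show "\<exists>U. open U \<and> x \<in> U \<and> smooth_on U (\<lambda>x. \<mu> (chart_inv c x))"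
      using U xy by blast
  qed
  with \<mu> that show ?thesis by blast
qed

end

section \<open>Sprays with a horizontally constant function\<close>

text \<open>
  Every Hamel spray with its adjoint function is an instance. The horizontal constancy of \<open>Q\<close> is
  what ties the curvature of the spray to \<open>Q\<close>.
\<close>
locale parallel_function = conical_manifold X A C
  for X :: "'m topology" and A :: "('m, 'n::finite) chart set" and C +
  fixes G :: "('m, 'n) chart \<Rightarrow> (real ^ 'n) \<times> (real ^ 'n) \<Rightarrow> real ^ 'n"
    and Q :: "('m, 'n) tangent \<Rightarrow> real"
  assumes spray_G: "spray A C G"
    and smooth_Q: "smooth_fun A C Q"
    and homogeneous_Q: "pos_homogeneous C 1 Q"
    and nonzero_Q: "\<xi> \<in> C \<Longrightarrow> Q \<xi> \<noteq> 0"
    and parallel_Q: "c \<in> A \<Longrightarrow> z \<in> coord_dom A C c \<Longrightarrow> hdelta (G c) k (coord_expr A c Q) z = 0"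

lemma (in conical_manifold) hamel_spray_parallel:
  assumes "hamel_spray A C H Q"
  shows "parallel_function X A C H Q"
proof -
  obtain G where G: "spray A C G" "hamel_function A C G Q" "associated_spray A C G Q H"
    using assms unfolding hamel_spray_def by blast
  show ?thesis
  proof
    show "spray A C H" "\<And>\<xi>. \<xi> \<in> C \<Longrightarrow> Q \<xi> \<noteq> 0" using G(3) by (auto simp: associated_spray_def)
    show "smooth_fun A C Q" "pos_homogeneous C 1 Q" using G(2) by (auto simp: hamel_function_def)
    fix c z k assume c: "c \<in> A" and z: "z \<in> coord_dom A C c"
    show "hdelta (H c) k (coord_expr A c Q) z = 0"
    proof (rule spray_domain.hdelta_associated_eq_0[OF spray_domain_coord_dom[OF G(1) c] _ _ _ _ _ z])
      show "smooth_on (coord_dom A C c) (coord_expr A c Q)" 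
        using G(2) c by (simp add: hamel_function_def smooth_fun_def)
      show "coord_pos_homogeneous (coord_dom A C c) 1 (coord_expr A c Q)" 
        using G(2) c pos_homogeneous_iff by (simp add: hamel_function_def)
      show "\<And>z. z \<in> coord_dom A C c \<Longrightarrow> coord_expr A c Q z \<noteq> 0"
        using G(3) tvec_in by (simp add: associated_spray_def coord_expr_def)
      show "\<And>z k. z \<in> coord_dom A C c \<Longrightarrow>
         hdelta (G c) k (coord_expr A c Q) z = vh_deriv0 (G c) k (coord_expr A c Q) z"
        using G(2) c by (simp add: hamel_function_def)
      show "\<And>z. z \<in> coord_dom A C c \<Longrightarrow>
         H c z = G c z + (hdelta0 (G c) (coord_expr A c Q) z / (2 * coord_expr A c Q z)) *\<^sub>R snd z"
        using G(3) c by (simp add: associated_spray_def)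
    qed
  qed
qed

context parallel_function
begin

abbreviation q where "q c \<equiv> coord_expr A c Q"

lemma smooth_q: "c \<in> A \<Longrightarrow> smooth_on (coord_dom A C c) (q c)"
  using smooth_Q by (simp add: smooth_fun_def)

lemma homogeneous_q: "c \<in> A \<Longrightarrow> coord_pos_homogeneous (coord_dom A C c) 1 (q c)"
  using homogeneous_Q pos_homogeneous_iff by blast

lemma nonzero_q: "z \<in> coord_dom A C c \<Longrightarrow> q c z \<noteq> 0"
  using nonzero_Q tvec_in by (simp add: coord_expr_def)

lemma euler_q:
  assumes "c \<in> A" "z \<in> coord_dom A C c"
  shows "(\<Sum>i\<in>UNIV. snd z $ i * dy i (q c) z) = q c z"
  using conic_domain.euler[OF conic_domain_coord_dom[OF assms(1)] smooth_q homogeneous_q assms(2)] assms(1)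
  by simp

lemma scalar_curvature_dataD:
  assumes "scalar_curvature_data A C G R \<tau>" "c \<in> A" "z \<in> coord_dom A C c"
  shows "riemann (G c) i k z = coord_expr A c R z * (if i = k then 1 else 0) - \<tau> c k z * snd z $ i"
  using assms unfolding scalar_curvature_data_def by blast

lemma curvature_formD:
  assumes "curvature_form A C G Q l" "c \<in> A" "z \<in> coord_dom A C c"
  shows "riemann (G c) i k z = coord_expr A c l z *
    ((q c z)\<^sup>2 * (if i = k then 1 else 0) - q c z * dy k (q c) z * snd z $ i)"
  using assms unfolding curvature_form_def by blast

section \<open>The curvature criteria\<close>

text \<open>Contract the curvature with \<open>Q\<^bsub>.i\<^esub>\<close>: the left-hand side vanishes, and Euler's relation leaves
  \<open>0 = R Q\<^bsub>.k\<^esub> - \<tau>\<^sub>k Q\<close>.\<close>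
lemma scalar_curvature_covector:
  assumes R: "scalar_curvature_data A C G R \<tau>" and c: "c \<in> A" and z: "z \<in> coord_dom A C c"
  shows "\<tau> c k z = coord_expr A c R z * dy k (q c) z / q c z"
proof -
  have "0 = (\<Sum>i\<in>UNIV. riemann (G c) i k z * dy i (q c) z)"
    using spray_domain.riemann_annihilates[OF spray_domain_coord_dom[OF spray_G c] smooth_q[OF c] parallel_Q[OF c] z]
    by simp
  also have "\<dots> = (\<Sum>i\<in>UNIV. coord_expr A c R z * ((if i = k then 1 else 0) * dy i (q c) z)
      - \<tau> c k z * (snd z $ i * dy i (q c) z))"
    by (simp only: scalar_curvature_dataD[OF R c z]) (simp add: algebra_simps)
  also have "\<dots> = coord_expr A c R z * dy k (q c) z - \<tau> c k z * q c z"
    by (simp add: sum_subtractf sum_distrib_left[symmetric] euler_q[OF c z] 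
        if_distrib[of "\<lambda>t. t * _"] cong: if_cong)
  finally show ?thesis using nonzero_q[OF z] by (simp add: field_simps)
qed

lemma scalar_curvature_data_imp_form:
  assumes R: "scalar_curvature_data A C G R \<tau>"
  shows "smooth_fun A C (\<lambda>\<xi>. R \<xi> / (Q \<xi>)\<^sup>2)" "curvature_form A C G Q (\<lambda>\<xi>. R \<xi> / (Q \<xi>)\<^sup>2)"
proof -
  have e: "coord_expr A c (\<lambda>\<xi>. R \<xi> / (Q \<xi>)\<^sup>2) = (\<lambda>z. coord_expr A c R z / (q c z * q c z))" for c
    by (auto simp: coord_expr_def power2_eq_square)
  have "smooth_fun A C R" using R by (simp add: scalar_curvature_data_def)
  then show "smooth_fun A C (\<lambda>\<xi>. R \<xi> / (Q \<xi>)\<^sup>2)"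
    unfolding smooth_fun_def e
    by (intro ballI smooth_on_divide smooth_on_mult smooth_q open_coord_dom) (auto simp: nonzero_q)
  show "curvature_form A C G Q (\<lambda>\<xi>. R \<xi> / (Q \<xi>)\<^sup>2)"
    unfolding curvature_form_def e
  proof (intro ballI allI)
    fix c z i k assume c: "c \<in> A" and z: "z \<in> coord_dom A C c"
    show "riemann (G c) i k z = coord_expr A c R z / (q c z * q c z) *
       ((q c z)\<^sup>2 * (if i = k then 1 else 0) - q c z * dy k (q c) z * snd z $ i)"
      using nonzero_q[OF z] unfolding scalar_curvature_dataD[OF R c z] scalar_curvature_covector[OF R c z]
      by (simp add: right_diff_distrib power2_eq_square)
  qed
qed

lemma form_imp_scalar_curvature_data:
  assumes l: "smooth_fun A C l" "pos_homogeneous C 0 l" "curvature_form A C G Q l"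
  shows "scalar_curvature_data A C G (\<lambda>\<xi>. l \<xi> * (Q \<xi> * Q \<xi>))
    (\<lambda>c k z. coord_expr A c l z * (q c z * dy k (q c) z))"
proof -
  have e: "coord_expr A c (\<lambda>\<xi>. l \<xi> * (Q \<xi> * Q \<xi>)) = (\<lambda>z. coord_expr A c l z * (q c z * q c z))" for c
    by (auto simp: coord_expr_def)
  have dq: "coord_pos_homogeneous (coord_dom A C c) 0 (dy k (q c))" if "c \<in> A" for c k
    using conic_domain.homogeneous_dy[OF conic_domain_coord_dom smooth_q] homogeneous_q that by simp
  show ?thesis
    unfolding scalar_curvature_data_def
  proof (intro conjI ballI allI)
    show "smooth_fun A C (\<lambda>\<xi>. l \<xi> * (Q \<xi> * Q \<xi>))"
      using l(1) unfolding smooth_fun_def e by (intro ballI smooth_on_mult smooth_q open_coord_dom) auto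
    show "pos_homogeneous C 2 (\<lambda>\<xi>. l \<xi> * (Q \<xi> * Q \<xi>))"
      using l(2) homogeneous_Q by (simp add: pos_homogeneous_def power2_eq_square)
    fix c k assume c: "c \<in> A"
    show "smooth_on (coord_dom A C c) (\<lambda>z. coord_expr A c l z * (q c z * dy k (q c) z))"
      using l(1) c smooth_q[OF c] unfolding dy_eq_dirder smooth_fun_def
      by (intro smooth_on_mult smooth_on_dirder open_coord_dom) auto
    show "coord_pos_homogeneous (coord_dom A C c) 1 (\<lambda>z. coord_expr A c l z * (q c z * dy k (q c) z))"
      using l(2)[unfolded pos_homogeneous_iff] homogeneous_q[OF c] dq[OF c, of k] c
      by (simp add: coord_pos_homogeneous_def)
  next
    fix c z i k assume cz: "c \<in> A" "z \<in> coord_dom A C c"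
    show "riemann (G c) i k z = coord_expr A c (\<lambda>\<xi>. l \<xi> * (Q \<xi> * Q \<xi>)) z * (if i = k then 1 else 0)
       - coord_expr A c l z * (q c z * dy k (q c) z) * snd z $ i"
      unfolding curvature_formD[OF l(3) cz] e by (simp add: algebra_simps power2_eq_square)
  qed
qed

text \<open>The trace \<open>(n - 1) \<lambda> Q\<^sup>2\<close> of the curvature is homogeneous of degree two, as is \<open>Q\<^sup>2\<close>.\<close>
lemma form_homogeneous:
  assumes l: "curvature_form A C G Q l" and n: "CARD('n) \<noteq> 1"
  shows "pos_homogeneous C 0 l"
  unfolding pos_homogeneous_iff
proof
  fix c assume c: "c \<in> A"
  have tr: "(\<Sum>i\<in>UNIV. riemann (G c) i i z) = (real CARD('n) - 1) * (coord_expr A c l z * (q c z)\<^sup>2)"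
    if z: "z \<in> coord_dom A C c" for z
  proof -
    have "(\<Sum>i\<in>UNIV. riemann (G c) i i z)
        = (\<Sum>i\<in>UNIV. coord_expr A c l z * (q c z)\<^sup>2 - coord_expr A c l z * q c z * (snd z $ i * dy i (q c) z))"
      unfolding curvature_formD[OF l c z] by (simp add: algebra_simps)
    also have "\<dots> = real CARD('n) * (coord_expr A c l z * (q c z)\<^sup>2) - coord_expr A c l z * q c z * q c z"
      by (simp add: sum_subtractf sum_distrib_left[symmetric] euler_q[OF c z])
    finally show ?thesis by (simp add: algebra_simps power2_eq_square)
  qed
  show "coord_pos_homogeneous (coord_dom A C c) 0 (coord_expr A c l)"
    unfolding coord_pos_homogeneous_def
  proof (intro ballI allI impI)
    fix z and r :: real assume z: "z \<in> coord_dom A C c" and r: "0 < r"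
    let ?z = "(fst z, r *\<^sub>R snd z)"
    have z': "?z \<in> coord_dom A C c"
      using conic_domain.cone[OF conic_domain_coord_dom[OF c] z r] .
    have "(\<Sum>i\<in>UNIV. riemann (G c) i i ?z) = r\<^sup>2 * (\<Sum>i\<in>UNIV. riemann (G c) i i z)"
      using spray_domain.homogeneous_riemann[OF spray_domain_coord_dom[OF spray_G c]] z r
      by (simp add: coord_pos_homogeneous_def sum_distrib_left)
    moreover have "q c ?z = r * q c z"
      using homogeneous_q[OF c] z r by (simp add: coord_pos_homogeneous_def)
    ultimately have "(real CARD('n) - 1) * (coord_expr A c l ?z * (r * q c z)\<^sup>2)
        = r\<^sup>2 * ((real CARD('n) - 1) * (coord_expr A c l z * (q c z)\<^sup>2))"
      using tr[OF z] tr[OF z'] by simp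
    then show "coord_expr A c l ?z = r ^ 0 *\<^sub>R coord_expr A c l z"
      using n r nonzero_q[OF z] by (simp add: power_mult_distrib)
  qed
qed

text \<open>In one variable \<open>Q\<^bsub>.1\<^esub> y\<^sup>1 = Q\<close>, so the curvature form is zero for every factor. The given factor may
  fail to be homogeneous, but 0 is homogeneous.\<close>
lemma form_one_dimensional:
  assumes l: "curvature_form A C G Q l" and n: "CARD('n) = 1"
  shows "curvature_form A C G Q (\<lambda>_. 0)"
proof -
  obtain a :: 'n where a: "UNIV = {a}" using n card_1_singletonE by blast
  have "riemann (G c) i k z = 0" if cz: "c \<in> A" "z \<in> coord_dom A C c" for c i k z
  proof -
    have ik: "i = a" "k = a" using a by auto
    have "snd z $ a * dy a (q c) z = q c z" using euler_q[OF cz] unfolding a by simp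
    then have e: "q c z * dy a (q c) z * snd z $ a = (q c z)\<^sup>2"
      by (simp add: power2_eq_square mult_ac)
    show ?thesis unfolding curvature_formD[OF l cz] ik e by simp
  qed
  then show ?thesis by (simp add: curvature_form_def coord_expr_def)
qed

theorem scalar_curvature_iff_form:
  "scalar_curvature A C G \<longleftrightarrow> (\<exists>l. smooth_fun A C l \<and> curvature_form A C G Q l)"
proof
  assume "scalar_curvature A C G"
  then show "\<exists>l. smooth_fun A C l \<and> curvature_form A C G Q l"
    unfolding scalar_curvature_def using scalar_curvature_data_imp_form by blast
next
  assume "\<exists>l. smooth_fun A C l \<and> curvature_form A C G Q l"
  then obtain l where l: "smooth_fun A C l" "curvature_form A C G Q l" by blast
  show "scalar_curvature A C G"
  proof (cases "CARD('n) = 1")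
    case True
    have "smooth_fun A C (\<lambda>_. 0)" "pos_homogeneous C 0 (\<lambda>_. 0 :: real)"
      by (simp_all add: smooth_fun_def coord_expr_def[abs_def] smooth_on_const pos_homogeneous_def)
    then show ?thesis
      using form_imp_scalar_curvature_data form_one_dimensional[OF l(2) True]
      unfolding scalar_curvature_def by blast
  next
    case False
    then show ?thesis
      using form_imp_scalar_curvature_data[OF l(1) form_homogeneous[OF l(2) False] l(2)]
      unfolding scalar_curvature_def by blast
  qed
qed

text \<open>The second summand is \<open>2 \<tau>\<^sub>i\<close> for the covector of the curvature form, so isotropy amounts to the vanishing
  of the first summand.\<close>
lemma dy_form_factor:
  assumes l: "smooth_fun A C l" and c: "c \<in> A" and z: "z \<in> coord_dom A C c"
  shows "dy i (\<lambda>z. coord_expr A c l z * (q c z * q c z)) z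
    = dy i (coord_expr A c l) z * (q c z * q c z) + 2 * (coord_expr A c l z * (q c z * dy i (q c) z))"
proof -
  have d: "coord_expr A c l differentiable (at z)" "q c differentiable (at z)"
    using l c z smooth_on_differentiable smooth_q[OF c] by (auto simp: smooth_fun_def)
  show ?thesis
    unfolding dy_eq_dirder
    by (simp add: dirder_mult d differentiable_mult algebra_simps)
qed

theorem isotropic_curvature_iff_form:
  "isotropic_curvature A C G \<longleftrightarrow>
    (\<exists>l. smooth_fun A C l \<and> locally_base_fun A C l \<and> curvature_form A C G Q l)"
proof
  assume "isotropic_curvature A C G"
  then obtain R \<tau> where R: "scalar_curvature_data A C G R \<tau>"
    and iso: "\<And>c z i. c \<in> A \<Longrightarrow> z \<in> coord_dom A C c \<Longrightarrow> dy i (coord_expr A c R) z = 2 * \<tau> c i z"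
    unfolding isotropic_curvature_def by blast
  define l where "l = (\<lambda>\<xi>. R \<xi> / (Q \<xi>)\<^sup>2)"
  note form = scalar_curvature_data_imp_form[OF R, folded l_def]
  have "dy i (coord_expr A c l) z = 0" if c: "c \<in> A" and z: "z \<in> coord_dom A C c" for c z i
  proof -
    have e: "coord_expr A c R w = coord_expr A c l w * (q c w * q c w)" if "w \<in> coord_dom A C c" for w
      using nonzero_Q[OF tvec_in[OF that]] by (simp add: l_def coord_expr_def power2_eq_square)
    have "dy i (coord_expr A c R) z = dy i (\<lambda>z. coord_expr A c l z * (q c z * q c z)) z"
      unfolding dy_eq_dirder by (rule dirder_cong[OF open_coord_dom[OF c] z e])
    moreover have "dy i (coord_expr A c R) z = 2 * (coord_expr A c l z * (q c z * dy i (q c) z))"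
      using iso[OF c z] scalar_curvature_covector[OF R c z] e[OF z] nonzero_q[OF z] by simp
    ultimately have "dy i (coord_expr A c l) z * (q c z * q c z) = 0"
      using dy_form_factor[OF form(1) c z] by simp
    then show ?thesis using nonzero_q[OF z] by simp
  qed
  then have "locally_base_fun A C l" using locally_base_fun_iff[OF form(1)] by blast
  with form show "\<exists>l. smooth_fun A C l \<and> locally_base_fun A C l \<and> curvature_form A C G Q l" by blast
next
  assume "\<exists>l. smooth_fun A C l \<and> locally_base_fun A C l \<and> curvature_form A C G Q l"
  then obtain l where l: "smooth_fun A C l" "locally_base_fun A C l" "curvature_form A C G Q l" by blast
  have "coord_expr A c (\<lambda>\<xi>. l \<xi> * (Q \<xi> * Q \<xi>)) = (\<lambda>z. coord_expr A c l z * (q c z * q c z))" for c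
    by (auto simp: coord_expr_def)
  then have "\<forall>c\<in>A. \<forall>z\<in>coord_dom A C c. \<forall>i. dy i (coord_expr A c (\<lambda>\<xi>. l \<xi> * (Q \<xi> * Q \<xi>))) z
      = 2 * (coord_expr A c l z * (q c z * dy i (q c) z))"
    using dy_form_factor[OF l(1)] l(2)[unfolded locally_base_fun_iff[OF l(1)]] by simp
  then show "isotropic_curvature A C G"
    using form_imp_scalar_curvature_data[OF l(1) locally_base_fun_homogeneous[OF l(2)] l(3)]
    unfolding isotropic_curvature_def by blast
qed

lemma base_form_imp_isotropic:
  assumes "smooth_base_fun A C \<mu>" "curvature_form A C G Q (\<lambda>\<xi>. \<mu> (fst \<xi>))"
  shows "isotropic_curvature A C G"
  using isotropic_curvature_iff_form base_fun_lift[OF assms(1)] assms(2) by blast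

lemma isotropic_imp_base_form:
  assumes conn: "connected_fibres A C" and "isotropic_curvature A C G"
  shows "\<exists>\<mu>. smooth_base_fun A C \<mu> \<and> curvature_form A C G Q (\<lambda>\<xi>. \<mu> (fst \<xi>))"
proof -
  obtain l where l: "smooth_fun A C l" "locally_base_fun A C l" "curvature_form A C G Q l"
    using assms(2) isotropic_curvature_iff_form by blast
  obtain \<mu> where \<mu>: "smooth_base_fun A C \<mu>" "\<And>\<xi>. \<xi> \<in> C \<Longrightarrow> l \<xi> = \<mu> (fst \<xi>)"
    using locally_base_fun_descends[OF conn l(1,2)] by blast
  have "coord_expr A c l z = coord_expr A c (\<lambda>\<xi>. \<mu> (fst \<xi>)) z" if "z \<in> coord_dom A C c" for c z
    using \<mu>(2)[OF tvec_in[OF that]] by (simp add: coord_expr_def)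
  with l(3) have "curvature_form A C G Q (\<lambda>\<xi>. \<mu> (fst \<xi>))" by (simp add: curvature_form_def)
  with \<mu>(1) show ?thesis by blast
qed

end

theorem theorem1p4:
  fixes X :: "'m topology"
    and A :: "('m, 'n::finite) chart set"
    and C :: "('m, 'n) tangent set"
    and Gbar :: "('m, 'n) chart \<Rightarrow> (real ^ 'n) \<times> (real ^ 'n) \<Rightarrow> real ^ 'n"
    and Q :: "('m, 'n) tangent \<Rightarrow> real"
  assumes "smooth_manifold X A"
    and "conical_region A C"
  shows
    "(hamel_spray A C Gbar Q \<longrightarrow>
        (scalar_curvature A C Gbar \<longleftrightarrow>
          (\<exists>l. smooth_fun A C l \<and> curvature_form A C Gbar Q l)))
     \<and>
     (funk_spray A C Gbar Q \<longrightarrow>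
        (connected_fibres A C \<longrightarrow>
          (isotropic_curvature A C Gbar \<longleftrightarrow>
            (\<exists>\<mu>. smooth_base_fun A C \<mu> \<and> curvature_form A C Gbar Q (\<lambda>\<xi>. \<mu> (fst \<xi>))))) \<and>
        ((\<exists>\<mu>. smooth_base_fun A C \<mu> \<and> curvature_form A C Gbar Q (\<lambda>\<xi>. \<mu> (fst \<xi>))) \<longrightarrow>
          isotropic_curvature A C Gbar) \<and>
        (isotropic_curvature A C Gbar \<longleftrightarrow>
          (\<exists>l. smooth_fun A C l \<and> locally_base_fun A C l \<and> curvature_form A C Gbar Q l)))"
proof (intro conjI impI)
  interpret conical_manifold X A C using assms by unfold_locales
  {
    assume "hamel_spray A C Gbar Q"
    then interpret parallel_function X A C Gbar Q by (rule hamel_spray_parallel)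
    show "scalar_curvature A C Gbar \<longleftrightarrow> (\<exists>l. smooth_fun A C l \<and> curvature_form A C Gbar Q l)"
      by (rule scalar_curvature_iff_form)
  }
  assume "funk_spray A C Gbar Q"
  then interpret parallel_function X A C Gbar Q
    by (intro hamel_spray_parallel funk_spray_imp_hamel_spray)
  show "isotropic_curvature A C Gbar"
    if "\<exists>\<mu>. smooth_base_fun A C \<mu> \<and> curvature_form A C Gbar Q (\<lambda>\<xi>. \<mu> (fst \<xi>))"
    using that base_form_imp_isotropic by blast
  show "isotropic_curvature A C Gbar \<longleftrightarrow>
      (\<exists>\<mu>. smooth_base_fun A C \<mu> \<and> curvature_form A C Gbar Q (\<lambda>\<xi>. \<mu> (fst \<xi>)))"
    if "connected_fibres A C"
    using isotropic_imp_base_form[OF that] base_form_imp_isotropic by blast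
  show "isotropic_curvature A C Gbar \<longleftrightarrow>
      (\<exists>l. smooth_fun A C l \<and> locally_base_fun A C l \<and> curvature_form A C Gbar Q l)"
    by (rule isotropic_curvature_iff_form)
qed

end
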